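(* Let $q\ge2$. Consider an urn with balls of $q$ colours with arbitrary initial numbers $N_{0,1},\dots,N_{0,q}$ of balls of each colour, where at each step one ball is drawn uniformly at random from the urn and discarded, and then one ball of each of the $q$ colours is added. Let $N_{n,j}$ be the number of balls of colour $j$ after $n$ steps. Then, as $n\to\infty$, \[ \frac{N_{n,j}-\frac{q-1}{q}n}{\sqrt n}\xrightarrow{d}\zeta_j \] jointly for $j=1,\dots,q$, where $(\zeta_1,\dots,\zeta_q)$ is jointly normal with mean $0$ and covariances \[ \operatorname{Cov}(\zeta_i,\zeta_j)=\frac{q-1}{q^2(q+1)}(q\delta_{i,j}-1),\qquad 1\le i,j\le q. \]
   Context: $\delta_{i,j}$ denotes the Kronecker delta; $\xrightarrow{d}$ denotes convergence in distribution. *)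

theory Defs
  imports "HOL-Probability.Probability"
begin

text \<open>
  An urn is the multiset of the colours of its balls, and the number of colours is
  \<open>CARD('q)\<close>. A uniformly drawn ball has the law \<open>pmf_of_multiset U\<close>,
  which is specified only for a nonempty urn \<open>U\<close>; an initially nonempty urn remains
  nonempty, since each step removes one ball and adds \<open>CARD('q) \<ge> 1\<close>.
\<close>

definition urn_step :: "'q::finite multiset \<Rightarrow> 'q multiset pmf" where
  "urn_step U = map_pmf (\<lambda>c. U - {#c#} + mset_set UNIV) (pmf_of_multiset U)"

text \<open>The law of the urn after \<open>n\<close> steps, started from \<open>U0\<close>.\<close>

primrec urn_law :: "'q::finite multiset \<Rightarrow> nat \<Rightarrow> 'q multiset pmf" where
  "urn_law U0 0 = return_pmf U0"
| "urn_law U0 (Suc n) = bind_pmf (urn_law U0 n) urn_step"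

definition weakly_converges ::
    "(nat \<Rightarrow> 'a::topological_space measure) \<Rightarrow> 'a measure \<Rightarrow> bool" where
  "weakly_converges \<mu> \<nu> \<longleftrightarrow>
     (\<forall>f :: 'a \<Rightarrow> real. continuous_on UNIV f \<and> bounded (range f) \<longrightarrow>
        (\<lambda>n. integral\<^sup>L (\<mu> n) f) \<longlonglongrightarrow> integral\<^sup>L \<nu> f)"

text \<open>Point masses count as (degenerate) normal laws.\<close>

definition normal_law :: "real measure \<Rightarrow> bool" where
  "normal_law \<mu> \<longleftrightarrow>
     (\<exists>m. \<mu> = return borel m) \<or>
     (\<exists>m \<sigma>. \<sigma> > 0 \<and> \<mu> = density lborel (\<lambda>x. ennreal (normal_density m \<sigma> x)))"

text \<open>
  A law on a Euclidean space is jointly normal if all its one-dimensional linear images are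
  normal; singular covariance matrices are therefore allowed.
\<close>

definition jointly_normal_law :: "'a::euclidean_space measure \<Rightarrow> bool" where
  "jointly_normal_law \<nu> \<longleftrightarrow>
     prob_space \<nu> \<and> sets \<nu> = sets borel \<and>
     (\<forall>t. normal_law (distr \<nu> borel (\<lambda>z. t \<bullet> z)))"

definition covariance :: "'a measure \<Rightarrow> ('a \<Rightarrow> real) \<Rightarrow> ('a \<Rightarrow> real) \<Rightarrow> real" where
  "covariance M X Y =
     integral\<^sup>L M (\<lambda>x. (X x - integral\<^sup>L M X) * (Y x - integral\<^sup>L M Y))"

text \<open>The vector of normalised colour counts of an urn \<open>U\<close> reached after \<open>n\<close> steps.\<close>

definition normalised_counts :: "nat \<Rightarrow> 'q::finite multiset \<Rightarrow> real ^ 'q" where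
  "normalised_counts n U =
     (\<chi> j. (real (count U j) - (real CARD('q) - 1) / real CARD('q) * real n) / sqrt (real n))"

end

theory Submission
  imports Defs "HOL-Real_Asymp.Real_Asymp"
begin

text \<open>
  For weights \<open>b\<close> with sum \<open>0\<close> let \<open>Z\<^sub>n\<close> be the sum of \<open>b j N\<^sub>n\<^sub>,\<^sub>j\<close>, and let
  \<open>T\<^sub>n\<close> be the deterministic number of balls. A step subtracts \<open>b c\<close> for the drawn colour \<open>c\<close>, with
  conditional mean \<open>Z\<^sub>n / T\<^sub>n\<close> and conditional second moment close to the average \<open>v\<close> of
  \<open>b\<^sup>2\<close>. Hence the characteristic functions satisfy
  \<open>\<phi>\<^sub>n\<^sub>+\<^sub>1(u) \<approx> \<phi>\<^sub>n(u (1 - 1 / T\<^sub>n)) exp(- u\<^sup>2 v / 2)\<close>.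
  Up to a lower order term in the exponent, \<open>exp(- u\<^sup>2 v T\<^sub>n / (2 (q + 1)))\<close> satisfies the same
  recursion. Since the argument only contracts, the errors add up, and their total is
  \<open>O(n\<^sup>-\<^sup>1\<^sup>/\<^sup>2)\<close> at \<open>u = n\<^sup>-\<^sup>1\<^sup>/\<^sup>2\<close>.
  Convergence of all characteristic functions and tightness, which follows from
  the bound \<open>E Z\<^sub>n\<^sup>2 = O(n)\<close>, give joint weak convergence.
\<close>

section \<open>Weak convergence from characteristic functions\<close>

text \<open>The phase \<open>a\<close> covers sines and constants, so addition alone generates
  everything needed. The frequencies \<open>t\<close> are arbitrary vectors, matching characteristic
  functions at all arguments.\<close>

inductive trig_polynomial :: "('a::real_inner \<Rightarrow> real) \<Rightarrow> bool" where
  cosine: "trig_polynomial (\<lambda>x. c * cos (t \<bullet> x + a))"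
| add: "trig_polynomial f \<Longrightarrow> trig_polynomial g \<Longrightarrow> trig_polynomial (\<lambda>x. f x + g x)"

lemma trig_polynomial_const: "trig_polynomial (\<lambda>x. c)"
  using trig_polynomial.cosine[of c 0 0] by simp

lemma trig_polynomial_sum:
  assumes "\<And>i. i \<in> A \<Longrightarrow> trig_polynomial (f i)"
  shows "trig_polynomial (\<lambda>x. \<Sum>i\<in>A. f i x)"
  using assms
  by (induction A rule: infinite_finite_induct)
    (auto intro: trig_polynomial.add trig_polynomial_const)

text \<open>The product-to-sum formula turns a product of two cosines into a sum of two cosines;
  induction on both factors does the rest. Together with sums this makes the class an
  algebra.\<close>

lemma trig_polynomial_mult:
  assumes f: "trig_polynomial f" and g: "trig_polynomial g"
  shows "trig_polynomial (\<lambda>x. f x * g x)"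
  using f
proof induction
  case (cosine c t a)
  show ?case
    using g
  proof induction
    case (cosine c' t' a')
    have eq: "c * cos (t \<bullet> x + a) * (c' * cos (t' \<bullet> x + a')) =
        (c * c' / 2) * cos ((t - t') \<bullet> x + (a - a')) + (c * c' / 2) * cos ((t + t') \<bullet> x + (a + a'))" for x
    proof -
      have "(t - t') \<bullet> x + (a - a') = (t \<bullet> x + a) - (t' \<bullet> x + a')"
        "(t + t') \<bullet> x + (a + a') = (t \<bullet> x + a) + (t' \<bullet> x + a')"
        by (simp_all add: inner_diff_left inner_add_left)
      then show ?thesis
        by (simp only: cos_diff cos_add) (simp add: algebra_simps)
    qed
    show ?case
      unfolding eq by (intro trig_polynomial.intros)
  next
    case (add g h)
    then show ?case
      by (simp only: distrib_left) (rule trig_polynomial.add)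
  qed
next
  case (add f h)
  then show ?case
    by (simp only: distrib_right) (rule trig_polynomial.add)
qed

text \<open>Polynomials are generated by linear functions, constants, sums and products. Only the
  linear case needs an argument: a sine is a cosine with phase \<open>- pi / 2\<close>.\<close>

lemma trig_polynomial_sin_compose:
  fixes p :: "'a::euclidean_space \<Rightarrow> real"
  assumes "real_polynomial_function p"
  shows "trig_polynomial (\<lambda>x. p (\<Sum>b\<in>Basis. sin (x \<bullet> b / r) *\<^sub>R b))"
  using assms
proof induction
  case (linear f)
  then interpret bounded_linear f .
  have eq: "f (\<Sum>b\<in>Basis. sin (x \<bullet> b / r) *\<^sub>R b) =
      (\<Sum>b\<in>Basis. f b * cos ((b /\<^sub>R r) \<bullet> x + (- pi / 2)))" for x
  proof -
    have "(b /\<^sub>R r) \<bullet> x = x \<bullet> b / r" for b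
      by (simp add: inner_commute divide_inverse_commute)
    moreover have "cos (y + (- pi / 2)) = sin y" for y
      unfolding cos_add by simp
    ultimately show ?thesis
      by (simp add: sum scale mult.commute del: add_uminus_conv_diff)
  qed
  show ?case
    unfolding eq by (intro trig_polynomial_sum trig_polynomial.cosine)
qed (auto intro: trig_polynomial_const trig_polynomial.add trig_polynomial_mult)

lemma trig_polynomial_integrable:
  fixes f :: "'a::euclidean_space \<Rightarrow> real"
  assumes "trig_polynomial f" and "finite_measure M" and M: "sets M = sets borel"
  shows "integrable M f"
proof -
  interpret finite_measure M by fact
  note [measurable_cong] = M
  show ?thesis
    using assms(1)
  proof induction
    case (cosine c t a)
    show ?case
      by (rule integrable_const_bound[where B = "\<bar>c\<bar>"]) (auto simp: abs_mult intro!: mult_left_le)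
  qed auto
qed

text \<open>The integral of a cosine with phase is the real part of a characteristic function times
  the constant \<open>iexp a\<close>, so convergence passes to the generators and, by linearity, to
  their sums.\<close>

lemma trig_polynomial_integral_tendsto:
  fixes M :: "nat \<Rightarrow> 'a::euclidean_space measure"
  assumes fin: "\<And>n. finite_measure (M n)" "finite_measure N"
    and sets: "\<And>n. sets (M n) = sets borel" "sets N = sets borel"
    and char: "\<And>t. (\<lambda>n. CLINT x|M n. iexp (t \<bullet> x)) \<longlonglongrightarrow> (CLINT x|N. iexp (t \<bullet> x))"
    and f: "trig_polynomial f"
  shows "(\<lambda>n. integral\<^sup>L (M n) f) \<longlonglongrightarrow> integral\<^sup>L N f"
  using f
proof induction
  case (cosine c t a)
  have eq: "(LINT x|P. c * cos (t \<bullet> x + a)) = c * Re (iexp a * (CLINT x|P. iexp (t \<bullet> x)))"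
    if "finite_measure P" "sets P = sets borel" for P :: "'a measure"
  proof -
    interpret finite_measure P by fact
    note [measurable_cong] = that(2)
    have int: "integrable P (\<lambda>x. iexp (t \<bullet> x))"
      by (rule integrable_const_bound[where B = 1]) auto
    have "Re (iexp a * (CLINT x|P. iexp (t \<bullet> x))) = (LINT x|P. Re (iexp a * iexp (t \<bullet> x)))"
      using int by (simp only: integral_Re integrable_mult_right flip: integral_mult_right_zero)
    also have "\<dots> = (LINT x|P. cos (t \<bullet> x + a))"
      by (simp add: Re_exp Im_exp cos_add mult.commute)
    finally show ?thesis
      by simp
  qed
  show ?case
    unfolding eq[OF fin(1) sets(1)] eq[OF fin(2) sets(2)]
    by (intro tendsto_intros char)
next
  case (add f g)
  then show ?case
    using fin sets by (auto simp: trig_polynomial_integrable intro!: tendsto_add)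
qed

text \<open>
  Precomposing \<open>f\<close> with \<open>x \<mapsto> r arcsin (sin (x / r))\<close> coordinatewise
  leaves it unchanged near the origin and makes it a continuous function of the sines,
  so that Weierstrass approximation on the cube yields a trigonometric polynomial
  which is close to it on the whole space.
\<close>

lemma trig_polynomial_approximation:
  fixes f :: "'a::euclidean_space \<Rightarrow> real"
  assumes f: "continuous_on UNIV f" and K: "\<And>x. \<bar>f x\<bar> \<le> K" and r: "r > 0" and e: "e > 0"
  obtains P where "trig_polynomial P" "\<And>x. \<bar>f x - P x\<bar> \<le> e + 2 * K * indicator {x. r < norm x} x"
proof -
  define G where "G y = f (\<Sum>b\<in>Basis. (r * arcsin (y \<bullet> b)) *\<^sub>R b)" for y
  define s :: "'a \<Rightarrow> 'a" where "s x = (\<Sum>b\<in>Basis. sin (x \<bullet> b / r) *\<^sub>R b)" for x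
  have s_in: "s x \<in> cbox (-One) One" for x
    by (simp add: s_def mem_box)
  have "continuous_on (cbox (-One) One) G"
    unfolding G_def
    by (intro continuous_on_compose2[OF f] continuous_intros continuous_on_arcsin) (auto simp: mem_box)
  then obtain p where p: "real_polynomial_function p"
      "\<And>y. y \<in> cbox (-One) One \<Longrightarrow> \<bar>G y - p y\<bar> < e"
    using Stone_Weierstrass_real_polynomial_function[of "cbox (-One) One" G e] e compact_cbox by blast
  have Gs: "G (s x) = f x" if "norm x \<le> r" for x
  proof -
    have "r * arcsin (s x \<bullet> b) = x \<bullet> b" if b: "b \<in> Basis" for b
    proof -
      have "\<bar>x \<bullet> b\<bar> \<le> r"
        using Basis_le_norm[OF b, of x] \<open>norm x \<le> r\<close> by linarith
      then have "\<bar>x \<bullet> b / r\<bar> \<le> 1"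
        using r by (simp add: field_simps)
      then have "arcsin (sin (x \<bullet> b / r)) = x \<bullet> b / r"
        using pi_gt3 by (intro arcsin_sin) linarith+
      then show ?thesis
        using r b by (simp add: s_def)
    qed
    then show ?thesis
      by (simp add: G_def euclidean_representation)
  qed
  have "\<bar>f x - p (s x)\<bar> \<le> e + 2 * K * indicator {x. r < norm x} x" for x
  proof (cases "norm x \<le> r")
    case True
    then show ?thesis
      using p(2)[OF s_in[of x]] Gs[OF True] by (simp add: indicator_def)
  next
    case False
    \<comment> \<open>Outside the ball nothing relates \<open>f x\<close> to \<open>G (s x)\<close>,
      but both are bounded by \<open>K\<close>; this produces the \<open>2 * K\<close> in the
      error.\<close>
    have "\<bar>G (s x)\<bar> \<le> K"
      by (simp add: G_def K)
    then show ?thesis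
      using p(2)[OF s_in[of x]] K[of x] False by (simp add: indicator_def)
  qed
  moreover have "trig_polynomial (\<lambda>x. p (s x))"
    unfolding s_def by (rule trig_polynomial_sin_compose[OF p(1)])
  ultimately show thesis
    using that by blast
qed

text \<open>The complements of the balls of integer radius decrease to the empty set, so their
  measures tend to 0 by continuity from above.\<close>

lemma tight_single:
  fixes N :: "'a::euclidean_space measure"
  assumes "finite_measure N" and N: "sets N = sets borel" and e: "e > 0"
  obtains r where "measure N {x. r < norm x} \<le> e"
proof -
  interpret finite_measure N by fact
  note [measurable_cong] = N
  have "{x. c < norm x} \<in> sets N" for c :: real
    unfolding N by (intro borel_open open_Collect_less continuous_intros)
  then have "(\<lambda>i. measure N {x. real i < norm x}) \<longlonglongrightarrow> measure N (\<Inter>i. {x. real i < norm x})"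
    by (intro finite_Lim_measure_decseq) (auto simp: decseq_def)
  moreover have "(\<Inter>i. {x. real i < norm x}) = ({} :: 'a set)"
    by (auto simp: not_less) (metis less_asym reals_Archimedean2)
  ultimately have "(\<lambda>i. measure N {x. real i < norm x}) \<longlonglongrightarrow> 0"
    by simp
  then have "\<forall>\<^sub>F i in sequentially. measure N {x. real i < norm x} < e"
    using e by (rule order_tendstoD)
  then show thesis
    using that by (auto simp: eventually_sequentially intro: less_imp_le)
qed

text \<open>A bounded continuous function is replaced by a trigonometric polynomial, whose integrals
  converge by the hypothesis on characteristic functions. The replacement is bad only outside a
  large ball, and tightness makes that error small uniformly in \<open>n\<close>.\<close>

theorem weakly_converges_if_char_tendsto:
  fixes M :: "nat \<Rightarrow> 'a::euclidean_space measure"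
  assumes prob: "\<And>n. prob_space (M n)" "prob_space N"
    and sets: "\<And>n. sets (M n) = sets borel" "sets N = sets borel"
    and char: "\<And>t. (\<lambda>n. CLINT x|M n. iexp (t \<bullet> x)) \<longlonglongrightarrow> (CLINT x|N. iexp (t \<bullet> x))"
    and tight: "\<And>e. e > 0 \<Longrightarrow> \<exists>r. \<forall>n. measure (M n) {x. r < norm x} \<le> e"
  shows "weakly_converges M N"
  unfolding weakly_converges_def
proof (intro allI impI, elim conjE)
  fix f :: "'a \<Rightarrow> real"
  assume f: "continuous_on UNIV f" and "bounded (range f)"
  then obtain K where K: "K > 0" "\<And>x. \<bar>f x\<bar> \<le> K"
    by (auto simp: bounded_pos)
  have fin: "finite_measure (M n)" "finite_measure N" for n
    using prob by (auto intro: prob_space.finite_measure)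
  show "(\<lambda>n. integral\<^sup>L (M n) f) \<longlonglongrightarrow> integral\<^sup>L N f"
  proof (rule LIMSEQ_I)
    fix e :: real
    assume e: "0 < e"
    \<comment> \<open>Two replacements cost at most \<open>2 * d\<close> each and the convergence
      for \<open>P\<close> costs less than \<open>d\<close>; the total stays below
      \<open>5 * d < e\<close>.\<close>
    define d where "d = e / 8"
    have d: "d > 0" "d / (2 * K) > 0"
      using e K by (auto simp: d_def)
    obtain r1 where r1: "\<And>n. measure (M n) {x. r1 < norm x} \<le> d / (2 * K)"
      using tight[OF d(2)] by blast
    obtain r2 where r2: "measure N {x. r2 < norm x} \<le> d / (2 * K)"
      using tight_single[OF fin(2) sets(2) d(2)] .
    define r where "r = max 1 (max r1 r2)"
    have "r > 0"
      by (simp add: r_def)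
    then obtain P where P: "trig_polynomial P"
        "\<And>x. \<bar>f x - P x\<bar> \<le> d + 2 * K * indicator {x. r < norm x} x"
      using trig_polynomial_approximation[OF f K(2) _ d(1)] by blast
    have close: "\<bar>integral\<^sup>L Q f - integral\<^sup>L Q P\<bar> \<le> 2 * d"
      if "prob_space Q" and Q: "sets Q = sets borel" and q: "measure Q {x. r' < norm x} \<le> d / (2 * K)"
        and "r' \<le> r" for Q r'
    proof -
      interpret prob_space Q by fact
      note [measurable_cong] = Q
      have [measurable]: "f \<in> borel_measurable borel"
        using f by (rule borel_measurable_continuous_onI)
      have S: "{x. c < norm x} \<in> sets Q" for c :: real
        unfolding Q by (intro borel_open open_Collect_less continuous_intros)
      have "measure Q {x. r < norm x} \<le> measure Q {x. r' < norm x}"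
        using \<open>r' \<le> r\<close> by (intro finite_measure_mono S) auto
      then have small: "measure Q {x. r < norm x} \<le> d / (2 * K)"
        using q by linarith
      have If: "integrable Q f"
        by (rule integrable_const_bound[where B = K]) (use K in auto)
      have IP: "integrable Q P"
        using P(1) finite_measure_axioms Q by (rule trig_polynomial_integrable)
      have Ii: "integrable Q (\<lambda>x. indicator {x. r < norm x} x :: real)"
        using S by (simp add: fmeasurable_def emeasure_eq_measure)
      have "\<bar>integral\<^sup>L Q f - integral\<^sup>L Q P\<bar> = \<bar>LINT x|Q. f x - P x\<bar>"
        using If IP by simp
      also have "\<dots> \<le> (LINT x|Q. \<bar>f x - P x\<bar>)"
        by (rule integral_abs_bound)
      also have "\<dots> \<le> (LINT x|Q. d + 2 * K * indicator {x. r < norm x} x)"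
        using If IP Ii P(2) by (intro integral_mono) auto
      also have "\<dots> = d + 2 * K * measure Q {x. r < norm x}"
        using Ii S by (simp add: prob_space)
      also have "\<dots> \<le> 2 * d"
        using small K(1) by (simp add: field_simps)
      finally show ?thesis .
    qed
    have M_close: "\<bar>integral\<^sup>L (M n) f - integral\<^sup>L (M n) P\<bar> \<le> 2 * d" for n
      by (rule close[OF prob(1) sets(1) r1]) (simp add: r_def)
    have N_close: "\<bar>integral\<^sup>L N f - integral\<^sup>L N P\<bar> \<le> 2 * d"
      by (rule close[OF prob(2) sets(2) r2]) (simp add: r_def)
    have "(\<lambda>n. integral\<^sup>L (M n) P) \<longlonglongrightarrow> integral\<^sup>L N P"
      by (rule trig_polynomial_integral_tendsto[OF fin sets char P(1)])
    then obtain n0 where n0: "\<And>n. n \<ge> n0 \<Longrightarrow> \<bar>integral\<^sup>L (M n) P - integral\<^sup>L N P\<bar> < d"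
      using d(1) by (metis LIMSEQ_D real_norm_def)
    have "norm (integral\<^sup>L (M n) f - integral\<^sup>L N f) < e" if "n \<ge> n0" for n
      using n0[OF that] M_close[of n] N_close d(1) unfolding d_def real_norm_def by linarith
    then show "\<exists>n0. \<forall>n\<ge>n0. norm (integral\<^sup>L (M n) f - integral\<^sup>L N f) < e"
      by blast
  qed
qed

section \<open>Gaussian vectors\<close>

text \<open>The parameter is the variance. At variance 0 the density formula would give the zero
  measure, hence the separate point mass.\<close>

definition centred_normal :: "real \<Rightarrow> real measure" where
  "centred_normal v =
     (if v = 0 then return borel 0 else density lborel (\<lambda>x. ennreal (normal_density 0 (sqrt v) x)))"

lemma normal_law_centred_normal: "v \<ge> 0 \<Longrightarrow> normal_law (centred_normal v)"
  unfolding normal_law_def centred_normal_def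
  by (metis less_eq_real_def real_sqrt_gt_zero)

text \<open>Scaling by \<open>sqrt v\<close> also covers \<open>v = 0\<close>, so the characteristic
  function and the moments below follow from the standard normal law without a case
  distinction.\<close>

lemma centred_normal_eq_distr:
  assumes "v \<ge> 0"
  shows "centred_normal v = distr std_normal_distribution borel (\<lambda>x. sqrt v * x)"
proof (cases "v = 0")
  case True
  interpret real_distribution std_normal_distribution
    by (rule real_dist_normal_dist)
  show ?thesis
    using True by (simp add: centred_normal_def)
next
  case False
  interpret real_distribution std_normal_distribution
    by (rule real_dist_normal_dist)
  have "distributed std_normal_distribution lborel (\<lambda>x. x) std_normal_density"
    by (simp add: distributed_def distr_id2 sets_eq_imp_space_eq)
  from normal_density_affine[OF this, of "sqrt v" 0]
  have "distributed std_normal_distribution lborel (\<lambda>x. sqrt v * x) (normal_density 0 (sqrt v))"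
    using assms False by simp
  then show ?thesis
    using False unfolding distributed_def
    by (simp add: centred_normal_def) (metis distr_cong sets_lborel)
qed

lemma
  assumes v: "v \<ge> 0"
  shows centred_normal_char: "(CLINT x|centred_normal v. iexp x) = exp (- v / 2)"
    and centred_normal_mean: "(LINT x|centred_normal v. x) = 0"
    and centred_normal_second_moment: "(LINT x|centred_normal v. x\<^sup>2) = v"
    and centred_normal_square_integrable: "integrable (centred_normal v) (\<lambda>x. x\<^sup>2)"
proof -
  note eq = centred_normal_eq_distr[OF v]
  have "(CLINT x|centred_normal v. iexp x) = char std_normal_distribution (sqrt v)"
    unfolding eq char_def by (simp add: integral_distr)
  also have "\<dots> = exp (- v / 2)"
    using v by (simp add: char_std_normal_distribution)
  finally show "(CLINT x|centred_normal v. iexp x) = exp (- v / 2)" .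
  show "(LINT x|centred_normal v. x) = 0"
    unfolding eq using integral_std_normal_distribution_moment_odd[of 1]
    by (simp add: integral_distr)
  show "(LINT x|centred_normal v. x\<^sup>2) = v"
    unfolding eq using v std_normal_distribution_even_moments(1)[of 1]
    by (simp add: integral_distr power_mult_distrib fact_numeral)
  show "integrable (centred_normal v) (\<lambda>x. x\<^sup>2)"
    unfolding eq using integrable_std_normal_distribution_moment[of 2]
    by (simp add: integrable_distr_eq power_mult_distrib)
qed

text \<open>A sum of independent centred normal variables is normal and the variances add. Summands
  with coefficient 0 are point masses without a density, so they are dropped first; if none remains,
  the sum is the point mass at 0.\<close>

lemma distr_linear_std_normal:
  fixes a :: "'i::finite \<Rightarrow> real"
  shows "distr (\<Pi>\<^sub>M i\<in>UNIV. std_normal_distribution) borel (\<lambda>\<omega>. \<Sum>i\<in>UNIV. a i * \<omega> i) =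
    centred_normal (\<Sum>i\<in>UNIV. (a i)\<^sup>2)"
proof -
  interpret N: real_distribution std_normal_distribution
    by (rule real_dist_normal_dist)
  interpret P: product_prob_space "\<lambda>i::'i. std_normal_distribution" UNIV
    by unfold_locales
  let ?P = "\<Pi>\<^sub>M i\<in>(UNIV :: 'i set). std_normal_distribution"
  define I where "I = {i. a i \<noteq> 0}"
  have sum_I: "(\<Sum>i\<in>UNIV. a i * \<omega> i) = (\<Sum>i\<in>I. a i * \<omega> i)" for \<omega>
    by (rule sum.mono_neutral_right) (auto simp: I_def)
  have sq_I: "(\<Sum>i\<in>UNIV. (a i)\<^sup>2) = (\<Sum>i\<in>I. (a i)\<^sup>2)"
    by (rule sum.mono_neutral_right) (auto simp: I_def)
  show ?thesis
  proof (cases "I = {}")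
    case True
    then show ?thesis
      unfolding sum_I sq_I by (simp add: centred_normal_def)
  next
    case False
    have marginal: "distr ?P borel (\<lambda>\<omega>. \<omega> i) = std_normal_distribution" for i
      using distr_PiM_component[of UNIV "\<lambda>i::'i. std_normal_distribution" i]
      by (simp add: N.prob_space_axioms cong: distr_cong)
    have "distributed ?P lborel (\<lambda>\<omega>. \<omega> i) std_normal_density" for i
      using marginal[of i] by (auto simp: distributed_def cong: distr_cong)
    then have normal: "distributed ?P lborel (\<lambda>\<omega>. a i * \<omega> i) (normal_density 0 \<bar>a i\<bar>)" if "i \<in> I" for i
      using P.normal_density_affine[of "\<lambda>\<omega>. \<omega> i" 0 1 "a i" 0] that by (simp add: I_def)
    \<comment> \<open>The coordinates have the product measure itself as joint law, which is the
      criterion for their independence.\<close>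
    have "distr ?P (\<Pi>\<^sub>M i\<in>UNIV. borel) (\<lambda>\<omega>. \<omega>) = ?P"
      by (intro distr_id2 sets_PiM_cong) auto
    then have "P.indep_vars (\<lambda>i. borel) (\<lambda>i \<omega>. \<omega> i) UNIV"
      by (subst P.indep_vars_iff_distr_eq_PiM') (simp_all add: marginal restrict_UNIV)
    then have "P.indep_vars (\<lambda>i. borel) (\<lambda>i \<omega>. \<omega> i) I"
      by (rule P.indep_vars_subset) simp
    then have indep: "P.indep_vars (\<lambda>i. borel) (\<lambda>i \<omega>. a i * \<omega> i) I"
      by (rule P.indep_vars_compose2) simp
    have "distributed ?P lborel (\<lambda>\<omega>. \<Sum>i\<in>I. a i * \<omega> i) (normal_density 0 (sqrt (\<Sum>i\<in>I. \<bar>a i\<bar>\<^sup>2)))"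
      using P.sum_indep_normal[OF _ False indep, of "\<lambda>i. \<bar>a i\<bar>" "\<lambda>_. 0"] normal
      by (simp add: I_def)
    moreover have "(\<Sum>i\<in>I. (a i)\<^sup>2) \<noteq> 0"
      using False by (subst sum_nonneg_eq_0_iff) (auto simp: I_def)
    ultimately show ?thesis
      unfolding sum_I sq_I by (simp add: distributed_def centred_normal_def cong: distr_cong)
  qed
qed

text \<open>The vector is the sum of the \<open>w i\<close> with independent standard normal
  coefficients, so its inner product with \<open>t\<close> has coefficients
  \<open>t \<bullet> w i\<close>. The \<open>w i\<close> need not span the space, which allows
  singular covariances.\<close>

lemma gaussian_vector_exists:
  fixes w :: "'i::finite \<Rightarrow> 'a::euclidean_space"
  obtains \<zeta> :: "'a measure" where "prob_space \<zeta>" "sets \<zeta> = sets borel"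
    "\<And>t. distr \<zeta> borel (\<lambda>z. t \<bullet> z) = centred_normal (\<Sum>i\<in>UNIV. (t \<bullet> w i)\<^sup>2)"
proof
  interpret N: real_distribution std_normal_distribution
    by (rule real_dist_normal_dist)
  interpret P: product_prob_space "\<lambda>i::'i. std_normal_distribution" UNIV
    by unfold_locales
  let ?P = "\<Pi>\<^sub>M i\<in>(UNIV :: 'i set). std_normal_distribution"
  let ?\<zeta> = "distr ?P borel (\<lambda>\<omega>. \<Sum>i\<in>UNIV. \<omega> i *\<^sub>R w i)"
  have meas [measurable]: "(\<lambda>\<omega>. \<Sum>i\<in>UNIV. \<omega> i *\<^sub>R w i) \<in> borel_measurable ?P"
    by measurable
  show "prob_space ?\<zeta>"
    by (rule P.prob_space_distr) (rule meas)
  show "sets ?\<zeta> = sets borel"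
    by simp
  show "distr ?\<zeta> borel (\<lambda>z. t \<bullet> z) = centred_normal (\<Sum>i\<in>UNIV. (t \<bullet> w i)\<^sup>2)" for t
    using distr_linear_std_normal[of "\<lambda>i. t \<bullet> w i"]
    by (simp add: distr_distr comp_def inner_sum_right mult.commute)
qed

text \<open>Everything is read off the one-dimensional images: the characteristic function at
  \<open>t\<close> is that of the image under \<open>t\<close> at argument 1, and the covariance
  comes from the variances by polarisation.\<close>

lemma
  fixes \<zeta> :: "'a::euclidean_space measure" and v :: "'a \<Rightarrow> real"
  assumes \<zeta>: "sets \<zeta> = sets borel"
    and law: "\<And>t. distr \<zeta> borel (\<lambda>z. t \<bullet> z) = centred_normal (v t)" and v: "\<And>t. v t \<ge> 0"
  shows gaussian_char: "(CLINT z|\<zeta>. iexp (t \<bullet> z)) = exp (- v t / 2)"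
    and gaussian_mean: "(LINT z|\<zeta>. t \<bullet> z) = 0"
    and gaussian_covariance:
      "covariance \<zeta> (\<lambda>z. s \<bullet> z) (\<lambda>z. t \<bullet> z) = (v (s + t) - v s - v t) / 2"
proof -
  note [measurable_cong] = \<zeta>
  show "(CLINT z|\<zeta>. iexp (t \<bullet> z)) = exp (- v t / 2)"
    using centred_normal_char[OF v[of t]] unfolding law[symmetric] by (simp add: integral_distr)
  have mean: "(LINT z|\<zeta>. t \<bullet> z) = 0" for t
    using centred_normal_mean[OF v[of t]] unfolding law[symmetric] by (simp add: integral_distr)
  then show "(LINT z|\<zeta>. t \<bullet> z) = 0" .
  have second: "(LINT z|\<zeta>. (t \<bullet> z)\<^sup>2) = v t" for t
    using centred_normal_second_moment[OF v[of t]] unfolding law[symmetric] by (simp add: integral_distr)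
  have int: "integrable \<zeta> (\<lambda>z. (t \<bullet> z)\<^sup>2)" for t
    using centred_normal_square_integrable[OF v[of t]] unfolding law[symmetric] by (simp add: integrable_distr_eq)
  have eq: "(s \<bullet> z) * (t \<bullet> z) = (((s + t) \<bullet> z)\<^sup>2 - (s \<bullet> z)\<^sup>2 - (t \<bullet> z)\<^sup>2) / 2" for z
    by (simp add: inner_add_left power2_eq_square algebra_simps)
  have "(LINT z|\<zeta>. (s \<bullet> z) * (t \<bullet> z)) =
      ((LINT z|\<zeta>. ((s + t) \<bullet> z)\<^sup>2) - (LINT z|\<zeta>. (s \<bullet> z)\<^sup>2) - (LINT z|\<zeta>. (t \<bullet> z)\<^sup>2)) / 2"
    unfolding eq by (simp add: int)
  then show "covariance \<zeta> (\<lambda>z. s \<bullet> z) (\<lambda>z. t \<bullet> z) = (v (s + t) - v s - v t) / 2"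
    unfolding covariance_def mean second by simp
qed

section \<open>The urn\<close>

text \<open>The linear functional \<open>Z\<close> of the overview, but with unrestricted weights:
  constant weights count balls, and centred squares of weights will measure the imbalance of the
  urn.\<close>

definition colour_sum :: "('q::finite \<Rightarrow> real) \<Rightarrow> 'q multiset \<Rightarrow> real" where
  "colour_sum b U = (\<Sum>j\<in>UNIV. b j * real (count U j))"

abbreviation urn_expectation ::
    "'q::finite multiset \<Rightarrow> nat \<Rightarrow> ('q multiset \<Rightarrow> 'b::{banach, second_countable_topology}) \<Rightarrow> 'b"
  where "urn_expectation U0 n \<equiv> measure_pmf.expectation (urn_law U0 n)"

lemma sum_count_UNIV: "(\<Sum>j\<in>UNIV. count U j) = size (U :: 'q::finite multiset)"
  unfolding size_multiset_overloaded_eq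
  by (rule sum.mono_neutral_right) (auto simp: not_in_iff)

lemma real_size_ge_1: "U \<noteq> {#} \<Longrightarrow> real (size U) \<ge> 1"
  by (metis One_nat_def Suc_leI nonempty_has_size of_nat_1 of_nat_le_iff)

lemma colour_sum_const: "colour_sum (\<lambda>_. c) U = c * real (size U)"
  by (simp add: colour_sum_def sum_count_UNIV flip: sum_distrib_left of_nat_sum)

lemma colour_sum_add: "colour_sum (\<lambda>j. b j + b' j) U = colour_sum b U + colour_sum b' U"
  by (simp add: colour_sum_def distrib_right sum.distrib)

lemma colour_sum_mono: "(\<And>j. b j \<le> b' j) \<Longrightarrow> colour_sum b U \<le> colour_sum b' U"
  unfolding colour_sum_def by (intro sum_mono mult_right_mono) auto

lemma abs_colour_sum_le:
  assumes "\<And>j. \<bar>b j\<bar> \<le> B"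
  shows "\<bar>colour_sum b U\<bar> \<le> B * real (size U)"
proof -
  have "\<bar>colour_sum b U\<bar> \<le> colour_sum (\<lambda>j. \<bar>b j\<bar>) U"
    unfolding colour_sum_def by (rule order_trans[OF sum_abs]) (simp add: abs_mult)
  also have "\<dots> \<le> colour_sum (\<lambda>_. B) U"
    by (intro colour_sum_mono assms)
  finally show ?thesis
    by (simp add: colour_sum_const)
qed

text \<open>The added balls contribute the constant sum of the weights, which vanishes for centred
  \<open>b\<close>. Membership of \<open>c\<close> ensures that the difference really removes a
  ball.\<close>

lemma colour_sum_step:
  assumes "c \<in># U"
  shows "colour_sum b (U - {#c#} + mset_set UNIV) = colour_sum b U - b c + (\<Sum>j\<in>UNIV. b j)"
proof -
  have "b j * real (count (U - {#c#} + mset_set UNIV) j) =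
      b j * real (count U j) - (if j = c then b j else 0) + b j" for j
    using assms by (auto simp: of_nat_diff Suc_le_eq algebra_simps)
  then have "colour_sum b (U - {#c#} + mset_set UNIV) =
      (\<Sum>j\<in>UNIV. b j * real (count U j) - (if j = c then b j else 0) + b j)"
    unfolding colour_sum_def by (intro sum.cong refl)
  then show ?thesis
    by (simp add: sum.distrib sum_subtractf colour_sum_def)
qed

lemma expectation_urn_step:
  fixes h :: "'q::finite multiset \<Rightarrow> 'b::{banach, second_countable_topology}"
  assumes "U \<noteq> {#}"
  shows "measure_pmf.expectation (urn_step U) h =
    (\<Sum>c\<in>UNIV. (real (count U c) / real (size U)) *\<^sub>R h (U - {#c#} + mset_set UNIV))"
  unfolding urn_step_def integral_map_pmf
  by (subst integral_measure_pmf[of UNIV]) (auto simp: assms)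

lemma finite_set_pmf_urn_law: "finite (set_pmf (urn_law (U0 :: 'q::finite multiset) n))"
proof (induction n)
  case (Suc n)
  have "finite (set_pmf (urn_step U))" for U :: "'q multiset"
    by (simp add: urn_step_def)
  with Suc show ?case
    by simp
qed simp

lemma integrable_urn_law [simp]:
  fixes h :: "'q::finite multiset \<Rightarrow> 'b::{banach, second_countable_topology}"
  shows "integrable (measure_pmf (urn_law U0 n)) h"
  by (rule integrable_measure_pmf_finite) (rule finite_set_pmf_urn_law)

lemma urn_expectation_Suc:
  fixes h :: "'q::finite multiset \<Rightarrow> 'b::{banach, second_countable_topology}"
  shows "urn_expectation U0 (Suc n) h =
    urn_expectation U0 n (\<lambda>U. measure_pmf.expectation (urn_step U) h)"
proof -
  have "finite (set_pmf (urn_step U))" for U :: "'q multiset"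
    by (simp add: urn_step_def)
  then have "urn_expectation U0 (Suc n) h = (\<Sum>U\<in>set_pmf (urn_law U0 n).
      pmf (urn_law U0 n) U *\<^sub>R measure_pmf.expectation (urn_step U) h)"
    by (simp add: pmf_expectation_bind finite_set_pmf_urn_law)
  also have "\<dots> = urn_expectation U0 n (\<lambda>U. measure_pmf.expectation (urn_step U) h)"
    by (rule integral_measure_pmf[symmetric]) (auto simp: finite_set_pmf_urn_law)
  finally show ?thesis .
qed

text \<open>The composition is random but the number of balls is not: each step adds
  \<open>CARD('q) - 1\<close> balls net. Hence the factors \<open>1 / T\<close> are constants that
  can be taken out of expectations.\<close>

lemma urn_law_size:
  fixes U0 :: "'q::finite multiset"
  assumes "U0 \<noteq> {#}" and "U \<in> set_pmf (urn_law U0 n)"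
  shows "U \<noteq> {#}" and "real (size U) = real (size U0) + real n * (real CARD('q) - 1)"
proof -
  have "U \<noteq> {#} \<and> real (size U) = real (size U0) + real n * (real CARD('q) - 1)"
    using assms(2)
  proof (induction n arbitrary: U)
    case 0
    then show ?case
      using assms(1) by simp
  next
    case (Suc n)
    then obtain V c where V: "V \<in> set_pmf (urn_law U0 n)"
      and U: "U = V - {#c#} + mset_set UNIV" and c: "c \<in># V"
      using Suc.IH by (auto simp: urn_step_def)
    have "real (size U) = real (size V) - 1 + real CARD('q)"
      using c by (simp add: U size_Diff_singleton of_nat_diff Suc_le_eq)
    moreover have "U \<noteq> {#}"
      using mset_set_empty_iff[of "UNIV :: 'q set"] by (auto simp: U)
    ultimately show ?case
      using Suc.IH[OF V] by (simp add: algebra_simps)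
  qed
  then show "U \<noteq> {#}" "real (size U) = real (size U0) + real n * (real CARD('q) - 1)"
    by auto
qed

lemma urn_expectation_mono:
  fixes f g :: "'q::finite multiset \<Rightarrow> real"
  assumes "\<And>U. U \<in> set_pmf (urn_law U0 n) \<Longrightarrow> f U \<le> g U"
  shows "urn_expectation U0 n f \<le> urn_expectation U0 n g"
  using assms by (intro integral_mono_AE) (auto simp: AE_measure_pmf_iff)

section \<open>Second moments of centred linear functionals\<close>

lemma urn_second_moment_step:
  assumes U: "U \<noteq> {#}" and b: "(\<Sum>j\<in>UNIV. b j) = 0" and B: "\<And>j. \<bar>b j\<bar> \<le> B"
  shows "measure_pmf.expectation (urn_step U) (\<lambda>V. (colour_sum b V)\<^sup>2) \<le> (colour_sum b U)\<^sup>2 + B\<^sup>2"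
proof -
  let ?Z = "colour_sum b U" and ?T = "real (size U)"
  let ?p = "\<lambda>c. real (count U c) / ?T"
  have T: "?T > 0"
    using U by (simp add: nonempty_has_size)
  have p1: "(\<Sum>c\<in>UNIV. ?p c) = 1"
    using U colour_sum_const[of 1 U] by (simp add: colour_sum_def flip: sum_divide_distrib)
  have pb: "(\<Sum>c\<in>UNIV. ?p c * b c) = ?Z / ?T"
    by (simp add: colour_sum_def sum_divide_distrib mult.commute)
  have "measure_pmf.expectation (urn_step U) (\<lambda>V. (colour_sum b V)\<^sup>2) =
      (\<Sum>c\<in>UNIV. ?p c * (?Z - b c)\<^sup>2)"
    unfolding expectation_urn_step[OF U]
    using colour_sum_step[of _ U b] b by (intro sum.cong refl) (force simp: not_in_iff[symmetric])
  also have "\<dots> = (\<Sum>c\<in>UNIV. ?p c * ?Z\<^sup>2 - 2 * ?Z * (?p c * b c) + ?p c * (b c)\<^sup>2)"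
    by (intro sum.cong refl) (simp add: power2_eq_square algebra_simps)
  also have "\<dots> = ?Z\<^sup>2 - 2 * ?Z * (?Z / ?T) + (\<Sum>c\<in>UNIV. ?p c * (b c)\<^sup>2)"
    unfolding sum.distrib sum_subtractf
    by (simp only: p1 pb mult_1_left flip: sum_distrib_left sum_distrib_right)
  also have "\<dots> \<le> ?Z\<^sup>2 + (\<Sum>c\<in>UNIV. ?p c * (b c)\<^sup>2)"
    using T by (simp add: mult.assoc)
  also have "(\<Sum>c\<in>UNIV. ?p c * (b c)\<^sup>2) \<le> (\<Sum>c\<in>UNIV. ?p c * B\<^sup>2)"
    using B by (intro sum_mono mult_left_mono) (auto simp: abs_le_square_iff[symmetric] intro: order_trans[OF B])
  also have "(\<Sum>c\<in>UNIV. ?p c * B\<^sup>2) = B\<^sup>2"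
    by (simp only: p1 mult_1_left flip: sum_distrib_right)
  finally show ?thesis
    by simp
qed

text \<open>This linear growth is used twice: for tightness, and to make the mean sizes of
  \<open>W / T\<close> and \<open>Z^2 / T^2\<close> small.\<close>

lemma urn_second_moment:
  assumes U0: "U0 \<noteq> {#}" and b: "(\<Sum>j\<in>UNIV. b j) = 0" and B: "\<And>j. \<bar>b j\<bar> \<le> B"
  shows "urn_expectation U0 n (\<lambda>U. (colour_sum b U)\<^sup>2) \<le> (colour_sum b U0)\<^sup>2 + real n * B\<^sup>2"
proof (induction n)
  case (Suc n)
  have "urn_expectation U0 (Suc n) (\<lambda>U. (colour_sum b U)\<^sup>2) \<le>
      urn_expectation U0 n (\<lambda>U. (colour_sum b U)\<^sup>2 + B\<^sup>2)"
    unfolding urn_expectation_Suc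
    by (intro urn_expectation_mono urn_second_moment_step b B urn_law_size(1)[OF U0])
  also have "\<dots> = urn_expectation U0 n (\<lambda>U. (colour_sum b U)\<^sup>2) + B\<^sup>2"
    by simp
  finally show ?case
    using Suc by (simp add: algebra_simps)
qed simp

section \<open>The characteristic function after one step\<close>

text \<open>The upper bound on \<open>exp (- y)\<close> rests on
  \<open>(1 - y + y^2 / 2) * (1 + y + y^2 / 2) = 1 + y^4 / 4\<close>, whose second factor is at most
  \<open>exp y\<close>. The gap \<open>x - y\<close> will come from the correction
  \<open>a / T\<close> in the Gaussian exponent.\<close>

lemma abs_one_minus_exp_le:
  fixes x y :: real
  assumes "0 \<le> y" "y \<le> x"
  shows "\<bar>1 - x - exp (- y)\<bar> \<le> (x - y) + y\<^sup>2 / 2"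
proof -
  have "1 - y \<le> exp (- y)"
    using exp_ge_add_one_self[of "- y"] by simp
  moreover have "exp (- y) \<le> 1 - y + y\<^sup>2 / 2"
  proof -
    have pos: "1 - y + y\<^sup>2 / 2 \<ge> 0"
      using sum_squares_bound[of 1 y] zero_le_power2[of "1 - y"] by (simp add: power2_eq_square algebra_simps)
    have "(1 - y + y\<^sup>2 / 2) * (1 + y + y\<^sup>2 / 2) = 1 + (y\<^sup>2)\<^sup>2 / 4"
      by (simp add: power2_eq_square field_simps)
    then have "1 \<le> (1 - y + y\<^sup>2 / 2) * (1 + y + y\<^sup>2 / 2)"
      by simp
    also have "\<dots> \<le> (1 - y + y\<^sup>2 / 2) * exp y"
      by (intro mult_left_mono pos exp_lower_Taylor_quadratic assms)
    finally show ?thesis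
      by (simp add: exp_minus field_simps)
  qed
  ultimately show ?thesis
    using assms by linarith
qed

lemma norm_iexp [simp]: "cmod (iexp x) = 1"
  by simp

lemma iexp_error_1: "cmod (iexp x - 1) \<le> \<bar>x\<bar>"
  using iexp_approx1[of x 0] by simp

lemma iexp_error_2: "cmod (iexp x - (1 + \<i> * x)) \<le> x\<^sup>2 / 2"
  using iexp_approx1[of x 1] by (simp add: fact_numeral eval_nat_numeral)

lemma iexp_error_3: "cmod (iexp x - (1 + \<i> * x - x\<^sup>2 / 2)) \<le> \<bar>x\<bar> ^ 3 / 6"
  using iexp_approx1[of x 2] by (simp add: fact_numeral eval_nat_numeral algebra_simps)

lemma iexp_add: "iexp (x + y) = iexp x * iexp y"
  by (simp add: distrib_left exp_add)

text \<open>
  The drift \<open>- Z / T\<close> of the linear functional \<open>Z\<close> contracts the argument of its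
  characteristic function by the factor \<open>1 - 1 / T\<close>. The Gaussian factor is the ratio of
  \<open>exp (- u\<^sup>2 v T / (2 (q + 1)))\<close> for consecutive values of \<open>u\<close> and \<open>T\<close>.
\<close>

lemma urn_step_char:
  fixes b :: "'q::finite \<Rightarrow> real" and u :: real
  assumes U: "U \<noteq> {#}" and b: "(\<Sum>j\<in>UNIV. b j) = 0" and B: "\<And>j. \<bar>b j\<bar> \<le> B"
    and v: "v = (\<Sum>j\<in>UNIV. (b j)\<^sup>2) / real CARD('q)"
  defines "T \<equiv> real (size U)" and "Z \<equiv> colour_sum b U" and "W \<equiv> colour_sum (\<lambda>j. (b j)\<^sup>2 - v) U"
    and "a \<equiv> v / (real CARD('q) + 1)"
  shows "cmod ((CLINT V|measure_pmf (urn_step U). iexp (u * colour_sum b V)) -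
      iexp (u * (1 - 1 / T) * Z) * exp (- (u\<^sup>2 * (v - a / T) / 2)))
    \<le> \<bar>u\<bar> ^ 3 * B ^ 3 + u ^ 4 * B ^ 4 + u\<^sup>2 * B\<^sup>2 / (2 * T) + u\<^sup>2 * \<bar>W\<bar> / (2 * T) + u\<^sup>2 * Z\<^sup>2 / (2 * T\<^sup>2)"
proof -
  let ?p = "\<lambda>c. real (count U c) / T"
  let ?q = "real CARD('q)"
  have T: "T \<ge> 1"
    unfolding T_def by (rule real_size_ge_1[OF U])
  have B0: "0 \<le> B"
    using B[of undefined] by linarith
  have p1: "(\<Sum>c\<in>UNIV. ?p c) = 1"
    using U colour_sum_const[of 1 U] by (simp add: T_def colour_sum_def flip: sum_divide_distrib)
  have pb: "(\<Sum>c\<in>UNIV. ?p c * b c) = Z / T"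
    by (simp add: Z_def colour_sum_def sum_divide_distrib mult.commute)
  \<comment> \<open>The conditional second moment is the uniform average \<open>v\<close> plus the
    imbalance \<open>W / T\<close>.\<close>
  have "(\<Sum>c\<in>UNIV. ?p c * (b c)\<^sup>2) = (\<Sum>c\<in>UNIV. ?p c * v) + (\<Sum>c\<in>UNIV. ?p c * ((b c)\<^sup>2 - v))"
    by (simp add: algebra_simps flip: sum.distrib)
  then have pb2: "(\<Sum>c\<in>UNIV. ?p c * (b c)\<^sup>2) = v + W / T"
    by (simp only: p1 mult_1_left flip: sum_distrib_right)
       (simp add: W_def colour_sum_def sum_divide_distrib mult.commute)
  have v0: "v \<ge> 0"
    by (simp add: v sum_nonneg)
  have "v \<le> (\<Sum>j\<in>(UNIV::'q set). B\<^sup>2) / ?q"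
    unfolding v using B by (intro divide_right_mono sum_mono) (auto simp: abs_le_square_iff[symmetric] intro: order_trans[OF B])
  then have vB: "v \<le> B\<^sup>2"
    by simp
  have a: "0 \<le> a" "a \<le> v"
    using v0 by (auto simp: a_def field_simps)
  have aT: "0 \<le> a / T" "a / T \<le> v"
    using a T mult_mono[of 1 T a v] by (auto simp: field_simps)
  \<comment> \<open>\<open>x\<close> is the phase of the drift, \<open>y\<close> the second-order
    term with variance \<open>v\<close>, and \<open>y'\<close> the slightly smaller exponent for
    which the Gaussian recursion is exact.\<close>
  define x where "x = u * Z / T"
  define y where "y = u\<^sup>2 * v / 2"
  define y' where "y' = u\<^sup>2 * (v - a / T) / 2"
  define S where "S = (\<Sum>c\<in>UNIV. ?p c * iexp (- u * b c))"
  have y: "0 \<le> y'" "y' \<le> y" "y - y' = u\<^sup>2 * a / (2 * T)" "y \<le> u\<^sup>2 * B\<^sup>2 / 2"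
    using aT vB by (auto simp: y_def y'_def intro!: mult_left_mono) (simp add: algebra_simps diff_divide_distrib)
  have xB: "\<bar>x\<bar> \<le> \<bar>u\<bar> * B"
  proof -
    have "\<bar>Z\<bar> \<le> B * T"
      unfolding Z_def T_def by (rule abs_colour_sum_le) (rule B)
    then have "\<bar>u\<bar> * \<bar>Z\<bar> \<le> \<bar>u\<bar> * (B * T)"
      by (intro mult_left_mono) auto
    then show ?thesis
      using T by (simp add: x_def abs_mult field_simps)
  qed
  have E: "(CLINT V|measure_pmf (urn_step U). iexp (u * colour_sum b V)) = iexp (u * Z) * S"
  proof -
    have "?p c *\<^sub>R iexp (u * colour_sum b (U - {#c#} + mset_set UNIV)) =
        iexp (u * Z) * (?p c * iexp (- u * b c))" for c
    proof (cases "c \<in># U")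
      case True
      then have "colour_sum b (U - {#c#} + mset_set UNIV) = Z - b c"
        using colour_sum_step[of c U b] b by (simp add: Z_def)
      moreover have "u * (Z - b c) = u * Z + (- u * b c)"
        by (simp add: algebra_simps)
      ultimately show ?thesis
        by (simp only: iexp_add) (simp add: scaleR_conv_of_real)
    next
      case False
      then show ?thesis
        by (simp add: not_in_iff)
    qed
    then show ?thesis
      unfolding expectation_urn_step[OF U] S_def sum_distrib_left T_def by (intro sum.cong refl)
  qed
  have "u * (1 - 1 / T) * Z = u * Z + - x"
    by (simp add: x_def algebra_simps)
  then have contr: "iexp (u * (1 - 1 / T) * Z) = iexp (u * Z) * iexp (- x)"
    by (simp only: iexp_add)
  \<comment> \<open>Second-order Taylor expansion under the sum: the weights turn the moments of
    \<open>b\<close> into \<open>1\<close>, \<open>Z / T\<close> and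
    \<open>v + W / T\<close>.\<close>
  have third: "cmod (S - (1 - \<i> * x - y - u\<^sup>2 * W / (2 * T))) \<le> \<bar>u\<bar> ^ 3 * B ^ 3 / 6"
  proof -
    define g where "g c = 1 + \<i> * complex_of_real (- u * b c) - complex_of_real ((- u * b c)\<^sup>2 / 2)" for c
    have "(\<Sum>c\<in>UNIV. ?p c * g c) = (\<Sum>c\<in>UNIV. complex_of_real (?p c) - \<i> * u * complex_of_real (?p c * b c)
        - u\<^sup>2 / 2 * complex_of_real (?p c * (b c)\<^sup>2))"
      by (intro sum.cong refl) (simp add: g_def algebra_simps power2_eq_square)
    also have "\<dots> = complex_of_real (\<Sum>c\<in>UNIV. ?p c) - \<i> * u * complex_of_real (\<Sum>c\<in>UNIV. ?p c * b c)
        - u\<^sup>2 / 2 * complex_of_real (\<Sum>c\<in>UNIV. ?p c * (b c)\<^sup>2)"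
      by (simp only: sum_subtractf sum_distrib_left of_real_sum)
    also have "\<dots> = 1 - \<i> * x - y - u\<^sup>2 * W / (2 * T)"
      unfolding p1 pb pb2 by (simp add: x_def y_def algebra_simps)
    finally have "S - (1 - \<i> * x - y - u\<^sup>2 * W / (2 * T)) = (\<Sum>c\<in>UNIV. ?p c * (iexp (- u * b c) - g c))"
      by (simp add: S_def right_diff_distrib sum_subtractf)
    also have "cmod \<dots> \<le> (\<Sum>c\<in>UNIV. ?p c * (\<bar>u\<bar> ^ 3 * B ^ 3 / 6))"
    proof (rule sum_norm_le)
      fix c
      have "cmod (iexp (- u * b c) - g c) \<le> \<bar>- u * b c\<bar> ^ 3 / 6"
        unfolding g_def using iexp_error_3[of "- u * b c"] by simp
      also have "\<dots> \<le> \<bar>u\<bar> ^ 3 * B ^ 3 / 6"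
        using B[of c] by (simp add: abs_mult power_mult_distrib mult_left_mono power_mono)
      finally have "?p c * cmod (iexp (- u * b c) - g c) \<le> ?p c * (\<bar>u\<bar> ^ 3 * B ^ 3 / 6)"
        using T by (intro mult_left_mono) auto
      then show "cmod (?p c * (iexp (- u * b c) - g c)) \<le> ?p c * (\<bar>u\<bar> ^ 3 * B ^ 3 / 6)"
        using T by (simp add: norm_mult norm_divide)
    qed
    also have "\<dots> = \<bar>u\<bar> ^ 3 * B ^ 3 / 6"
      by (simp only: p1 mult_1_left flip: sum_distrib_right)
    finally show ?thesis .
  qed
  have second: "cmod ((1 - \<i> * x) - iexp (- x)) \<le> x\<^sup>2 / 2"
    using iexp_error_2[of "- x"] by (simp add: norm_minus_commute)
  have first: "cmod (complex_of_real y * (iexp (- x) - 1)) \<le> \<bar>u\<bar> ^ 3 * B ^ 3 / 2"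
  proof -
    have "cmod (complex_of_real y * (iexp (- x) - 1)) = y * cmod (iexp (- x) - 1)"
      using y by (simp add: norm_mult)
    also have "\<dots> \<le> (u\<^sup>2 * B\<^sup>2 / 2) * (\<bar>u\<bar> * B)"
      using y xB iexp_error_1[of "- x"] by (intro mult_mono) auto
    also have "\<dots> = \<bar>u\<bar> ^ 3 * B ^ 3 / 2"
      by (simp add: eval_nat_numeral algebra_simps flip: power2_abs[of u])
    finally show ?thesis .
  qed
  have gauss: "cmod (iexp (- x) * complex_of_real (1 - y - exp (- y'))) \<le> u\<^sup>2 * B\<^sup>2 / (2 * T) + u ^ 4 * B ^ 4 / 8"
  proof -
    have "cmod (iexp (- x) * complex_of_real (1 - y - exp (- y'))) = \<bar>1 - y - exp (- y')\<bar>"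
      by (simp only: norm_mult norm_iexp norm_of_real) simp
    also have "\<dots> \<le> (y - y') + y'\<^sup>2 / 2"
      using y by (intro abs_one_minus_exp_le) auto
    also have "y - y' \<le> u\<^sup>2 * B\<^sup>2 / (2 * T)"
      unfolding y(3) using a vB T by (intro divide_right_mono mult_left_mono) auto
    also have "y'\<^sup>2 \<le> (u\<^sup>2 * B\<^sup>2 / 2)\<^sup>2"
      using y by (intro power_mono) auto
    also have "(u\<^sup>2 * B\<^sup>2 / 2)\<^sup>2 = u ^ 4 * B ^ 4 / 4"
      by (simp add: power_mult_distrib power_divide flip: power_mult)
    finally show ?thesis
      by simp
  qed
  \<comment> \<open>Telescoping: the Taylor remainder, the linearisation of the drift phase, its
    interaction with \<open>y\<close>, the replacement of \<open>1 - y\<close> by the Gaussian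
    factor, and the imbalance \<open>W\<close>.\<close>
  have split: "S - iexp (- x) * exp (- y') =
      (S - (1 - \<i> * x - y - u\<^sup>2 * W / (2 * T))) + ((1 - \<i> * x) - iexp (- x))
      + complex_of_real y * (iexp (- x) - 1) + iexp (- x) * complex_of_real (1 - y - exp (- y'))
      + complex_of_real (- (u\<^sup>2 * W / (2 * T)))"
    by (simp add: algebra_simps exp_of_real)
  have "cmod (S - iexp (- x) * exp (- y')) \<le> \<bar>u\<bar> ^ 3 * B ^ 3 / 6 + x\<^sup>2 / 2 + \<bar>u\<bar> ^ 3 * B ^ 3 / 2
      + (u\<^sup>2 * B\<^sup>2 / (2 * T) + u ^ 4 * B ^ 4 / 8) + \<bar>u\<^sup>2 * W / (2 * T)\<bar>"
    unfolding split
    by (intro norm_triangle_mono third second first gauss) (simp only: norm_of_real abs_minus_cancel order_refl)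
  also have "\<dots> \<le> \<bar>u\<bar> ^ 3 * B ^ 3 + u ^ 4 * B ^ 4 + u\<^sup>2 * B\<^sup>2 / (2 * T) + u\<^sup>2 * \<bar>W\<bar> / (2 * T) + u\<^sup>2 * Z\<^sup>2 / (2 * T\<^sup>2)"
  proof -
    have "\<bar>u\<bar> ^ 3 * B ^ 3 \<ge> 0" "u ^ 4 * B ^ 4 \<ge> 0"
      using B0 by auto
    moreover have "\<bar>u\<^sup>2 * W / (2 * T)\<bar> = u\<^sup>2 * \<bar>W\<bar> / (2 * T)" "x\<^sup>2 / 2 = u\<^sup>2 * Z\<^sup>2 / (2 * T\<^sup>2)"
      using T by (simp_all add: x_def abs_mult power_mult_distrib power_divide)
    ultimately show ?thesis
      by linarith
  qed
  finally have bound: "cmod (S - iexp (- x) * exp (- y')) \<le> \<dots>" .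
  have "(CLINT V|measure_pmf (urn_step U). iexp (u * colour_sum b V)) -
      iexp (u * (1 - 1 / T) * Z) * exp (- (u\<^sup>2 * (v - a / T) / 2)) =
      iexp (u * Z) * (S - iexp (- x) * exp (- y'))"
    unfolding E contr y'_def[symmetric] by (simp add: algebra_simps)
  then have "cmod ((CLINT V|measure_pmf (urn_step U). iexp (u * colour_sum b V)) -
      iexp (u * (1 - 1 / T) * Z) * exp (- (u\<^sup>2 * (v - a / T) / 2))) = cmod (S - iexp (- x) * exp (- y'))"
    by (simp only: norm_mult norm_iexp mult_1_left)
  with bound show ?thesis
    by simp
qed

section \<open>Accumulation of the one-step errors\<close>

text \<open>The bound telescopes: \<open>1 / ?y \<le> 2 * (?y - ?x)\<close> for consecutive square
  roots, because \<open>(?y - ?x) * (?y + ?x) = 1\<close>.\<close>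

lemma sum_inverse_sqrt_le: "(\<Sum>k<n. 1 / sqrt (real k + 1)) \<le> 2 * sqrt (real n)"
proof (induction n)
  case (Suc n)
  let ?x = "sqrt (real n)" and ?y = "sqrt (real n + 1)"
  have y: "?y > 0" "?x \<le> ?y"
    by auto
  have "(?y - ?x) * (?y + ?x) = 1"
    by (simp add: algebra_simps)
  also have "(?y - ?x) * (?y + ?x) \<le> (?y - ?x) * (2 * ?y)"
    using y by (intro mult_left_mono) auto
  finally have "1 / ?y \<le> 2 * (?y - ?x)"
    using y(1) by (simp add: field_simps)
  then show ?case
    using Suc by (simp add: add.commute)
qed simp

lemma urn_expectation_add:
  fixes f g :: "'q::finite multiset \<Rightarrow> 'b::{banach, second_countable_topology}"
  shows "urn_expectation U0 n (\<lambda>U. f U + g U) = urn_expectation U0 n f + urn_expectation U0 n g"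
  by simp

text \<open>Both second moments grow at most linearly while \<open>T \<ge> real n + 1\<close>. The
  \<open>W\<close> term is therefore of order \<open>u^2 / sqrt (real n + 1)\<close>, and the
  \<open>Z\<close> term is even smaller.\<close>

lemma expected_error_le:
  fixes U0 :: "'q::finite multiset" and u B K :: real
  assumes q: "CARD('q) \<ge> 2" and U0: "U0 \<noteq> {#}"
    and K: "K \<ge> 0"
      "urn_expectation U0 n (\<lambda>U. (Z U)\<^sup>2) \<le> K * (real n + 1)"
      "urn_expectation U0 n (\<lambda>U. (W U)\<^sup>2) \<le> K * (real n + 1)"
  defines "T \<equiv> real (size U0) + real n * (real CARD('q) - 1)"
  shows "urn_expectation U0 n (\<lambda>U. \<bar>u\<bar> ^ 3 * B ^ 3 + u ^ 4 * B ^ 4 + u\<^sup>2 * B\<^sup>2 / (2 * T)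
      + u\<^sup>2 * \<bar>W U\<bar> / (2 * T) + u\<^sup>2 * (Z U)\<^sup>2 / (2 * T\<^sup>2))
    \<le> \<bar>u\<bar> ^ 3 * B ^ 3 + u ^ 4 * B ^ 4 + (B\<^sup>2 + K + 1) * (u\<^sup>2 / sqrt (real n + 1))"
proof -
  define s where "s = sqrt (real n + 1)"
  have s: "s \<ge> 1" "s\<^sup>2 = real n + 1"
    by (auto simp: s_def)
  have "real n * 1 \<le> real n * (real CARD('q) - 1)"
    using q by (intro mult_left_mono) auto
  moreover have "real (size U0) \<ge> 1"
    by (rule real_size_ge_1[OF U0])
  ultimately have T: "T \<ge> s\<^sup>2"
    by (simp add: T_def s)
  have T1: "T \<ge> s"
    using T s(1) by (metis order_trans self_le_power zero_less_numeral)
  let ?E = "urn_expectation U0 n"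
  have EW: "?E (\<lambda>U. \<bar>W U\<bar>) \<le> (K + 1) / 2 * s"
  proof -
    \<comment> \<open>The arithmetic-geometric mean inequality, balanced at the scale
      \<open>s\<close> of \<open>W\<close>, serves in place of Cauchy-Schwarz.\<close>
    have "\<bar>W U\<bar> \<le> (W U)\<^sup>2 * (1 / (2 * s)) + s / 2" for U
      using sum_squares_bound[of "\<bar>W U\<bar>" s] s(1) by (simp add: field_simps power2_eq_square)
    then have "?E (\<lambda>U. \<bar>W U\<bar>) \<le> ?E (\<lambda>U. (W U)\<^sup>2 * (1 / (2 * s)) + s / 2)"
      by (intro urn_expectation_mono)
    also have "\<dots> = ?E (\<lambda>U. (W U)\<^sup>2) * (1 / (2 * s)) + s / 2"
      by simp
    also have "\<dots> \<le> (K * s\<^sup>2) * (1 / (2 * s)) + s / 2"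
      using K(3) s by (intro add_right_mono mult_right_mono) auto
    also have "\<dots> = (K + 1) / 2 * s"
      using s(1) by (simp add: field_simps power2_eq_square)
    finally show ?thesis .
  qed
  have "?E (\<lambda>U. \<bar>u\<bar> ^ 3 * B ^ 3 + u ^ 4 * B ^ 4 + u\<^sup>2 * B\<^sup>2 / (2 * T)
      + u\<^sup>2 * \<bar>W U\<bar> / (2 * T) + u\<^sup>2 * (Z U)\<^sup>2 / (2 * T\<^sup>2)) =
      \<bar>u\<bar> ^ 3 * B ^ 3 + u ^ 4 * B ^ 4
      + u\<^sup>2 * (B\<^sup>2 / (2 * T) + ?E (\<lambda>U. \<bar>W U\<bar>) / (2 * T) + ?E (\<lambda>U. (Z U)\<^sup>2) / (2 * T\<^sup>2))"
    by (simp add: distrib_left)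
  also have "\<dots> \<le> \<bar>u\<bar> ^ 3 * B ^ 3 + u ^ 4 * B ^ 4 + u\<^sup>2 * ((B\<^sup>2 + K + 1) / s)"
  proof (intro add_left_mono mult_left_mono)
    have "B\<^sup>2 / (2 * T) \<le> B\<^sup>2 / s"
      using T1 s by (intro divide_left_mono) auto
    moreover have "?E (\<lambda>U. \<bar>W U\<bar>) / (2 * T) \<le> ((K + 1) / 2 * s) / (2 * s\<^sup>2)"
      using EW T s K(1) by (intro frac_le) auto
    moreover have "((K + 1) / 2 * s) / (2 * s\<^sup>2) = (K + 1) / 4 / s"
      using s(1) by (simp add: power2_eq_square)
    moreover have "?E (\<lambda>U. (Z U)\<^sup>2) / (2 * T\<^sup>2) \<le> (K * s\<^sup>2) / (2 * (s * s\<^sup>2))"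
    proof (intro frac_le)
      have "s * s\<^sup>2 \<le> T * T"
        using T T1 s by (intro mult_mono) auto
      then show "2 * (s * s\<^sup>2) \<le> 2 * T\<^sup>2"
        by (simp add: power2_eq_square)
    qed (use K s in auto)
    moreover have "(K * s\<^sup>2) / (2 * (s * s\<^sup>2)) = K / 2 / s"
      using s(1) by simp
    moreover have "B\<^sup>2 / s + ((K + 1) / 4 / s + K / 2 / s) \<le> (B\<^sup>2 + K + 1) / s"
      using s K(1) by (simp add: field_simps)
    ultimately show "B\<^sup>2 / (2 * T) + ?E (\<lambda>U. \<bar>W U\<bar>) / (2 * T) + ?E (\<lambda>U. (Z U)\<^sup>2) / (2 * T\<^sup>2)
        \<le> (B\<^sup>2 + K + 1) / s"
      by linarith
  qed simp
  finally show ?thesis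
    by (simp add: s_def mult.commute)
qed

text \<open>Induction on \<open>n\<close> for all \<open>u\<close> at once, since one step passes
  from \<open>u\<close> to \<open>u * (1 - 1 / T n)\<close>. This argument is no larger in absolute
  value and the Gaussian factor is at most 1, so earlier errors are not amplified. The first term of
  the bound is the mismatch at time 0.\<close>

lemma urn_char_error:
  fixes U0 :: "'q::finite multiset" and b :: "'q \<Rightarrow> real"
  assumes q: "CARD('q) \<ge> 2" and U0: "U0 \<noteq> {#}" and b: "(\<Sum>j\<in>UNIV. b j) = 0"
  defines "a \<equiv> (\<Sum>j\<in>UNIV. (b j)\<^sup>2) / real CARD('q) / (real CARD('q) + 1)"
    and "T \<equiv> \<lambda>n. real (size U0) + real n * (real CARD('q) - 1)"
  obtains C where "C \<ge> 0" "\<And>n u. cmod ((CLINT U|measure_pmf (urn_law U0 n). iexp (u * colour_sum b U))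
        - exp (- (u\<^sup>2 * a * T n / 2)))
      \<le> C * (\<bar>u\<bar> + u\<^sup>2) + (\<Sum>k<n. C * (\<bar>u\<bar> ^ 3 + u ^ 4 + u\<^sup>2 / sqrt (real k + 1)))"
proof -
  let ?q = "real CARD('q)"
  define v where "v = (\<Sum>j\<in>UNIV. (b j)\<^sup>2) / ?q"
  have a_v: "a = v / (?q + 1)"
    by (simp add: a_def v_def)
  define b2 where "b2 j = (b j)\<^sup>2 - v" for j
  have b2: "(\<Sum>j\<in>UNIV. b2 j) = 0"
    by (simp add: b2_def sum_subtractf v_def)
  define B where "B = (\<Sum>j\<in>UNIV. \<bar>b j\<bar> + \<bar>b2 j\<bar>)"
  have B_sum: "\<bar>b j\<bar> + \<bar>b2 j\<bar> \<le> B" for j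
    unfolding B_def by (rule member_le_sum) auto
  have B: "\<bar>b j\<bar> \<le> B" "\<bar>b2 j\<bar> \<le> B" for j
    using B_sum[of j] by linarith+
  have B0: "B \<ge> 0"
    using B(1)[of undefined] by linarith
  have a0: "a \<ge> 0"
    by (simp add: a_def sum_nonneg)
  define K where "K = (colour_sum b U0)\<^sup>2 + (colour_sum b2 U0)\<^sup>2 + B\<^sup>2"
  have K0: "K \<ge> 0"
    by (simp add: K_def)
  have K: "(colour_sum c U0)\<^sup>2 + real n * B\<^sup>2 \<le> K * (real n + 1)" if "c = b \<or> c = b2" for c n
  proof -
    have "(colour_sum c U0)\<^sup>2 \<le> K" "real n * B\<^sup>2 \<le> real n * K"
      using that by (auto simp: K_def intro!: mult_left_mono)
    then show ?thesis
      by (simp add: algebra_simps)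
  qed
  define C where "C = B ^ 3 + B ^ 4 + (B\<^sup>2 + K + 1) + \<bar>colour_sum b U0\<bar> + a * real (size U0)"
  have C0: "C \<ge> 0"
    unfolding C_def using B0 K0 a0 by (intro add_nonneg_nonneg) auto
  have C: "B ^ 3 \<le> C" "B ^ 4 \<le> C" "B\<^sup>2 + K + 1 \<le> C" "\<bar>colour_sum b U0\<bar> \<le> C" "a * real (size U0) \<le> C"
    unfolding C_def using B0 K0 a0
      zero_le_power[OF B0, of 3] zero_le_power[OF B0, of 4] zero_le_power[OF B0, of 2]
      mult_nonneg_nonneg[OF a0, of "real (size U0)"] by linarith+
  define err where "err k u = C * (\<bar>u\<bar> ^ 3 + u ^ 4 + u\<^sup>2 / sqrt (real k + 1))" for k :: nat and u :: real
  define \<phi> where "\<phi> n u = (CLINT U|measure_pmf (urn_law U0 n). iexp (u * colour_sum b U))" for n u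
  define g where "g n u = complex_of_real (exp (- (u\<^sup>2 * a * T n / 2)))" for n u
  have T1: "T n \<ge> 1" for n
  proof -
    have "real (size U0) \<ge> 1"
      by (rule real_size_ge_1[OF U0])
    moreover have "real n * (?q - 1) \<ge> 0"
      using q by simp
    ultimately show ?thesis
      unfolding T_def by linarith
  qed
  have "cmod (\<phi> n u - g n u) \<le> C * (\<bar>u\<bar> + u\<^sup>2) + (\<Sum>k<n. err k u)" for n u
  proof (induction n arbitrary: u)
    case 0
    let ?x = "u * colour_sum b U0" and ?y = "u\<^sup>2 * a * real (size U0) / 2"
    have "\<phi> 0 u - g 0 u = (iexp ?x - 1) + complex_of_real (1 - exp (- ?y))"
      by (simp add: \<phi>_def g_def T_def)
    also have "cmod \<dots> \<le> \<bar>?x\<bar> + \<bar>1 - exp (- ?y)\<bar>"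
      by (intro norm_triangle_mono iexp_error_1) (simp only: norm_of_real order_refl)
    also have "\<bar>1 - exp (- ?y)\<bar> \<le> ?y"
      using exp_ge_add_one_self[of "- ?y"] a0 by simp
    also have "\<bar>?x\<bar> + ?y \<le> C * \<bar>u\<bar> + C * u\<^sup>2"
    proof (intro add_mono)
      show "\<bar>?x\<bar> \<le> C * \<bar>u\<bar>"
        using mult_left_mono[OF C(4), of "\<bar>u\<bar>"] by (simp add: abs_mult mult.commute)
      have "?y \<le> u\<^sup>2 * (a * real (size U0))"
        using a0 by simp
      also have "\<dots> \<le> u\<^sup>2 * C"
        by (intro mult_left_mono C) simp
      finally show "?y \<le> C * u\<^sup>2"
        by (simp add: mult.commute)
    qed
    finally show ?case
      by (simp add: distrib_left)
  next
    case (Suc n)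
    let ?E = "urn_expectation U0 n"
    define u' where "u' = u * (1 - 1 / T n)"
    define e where "e = complex_of_real (exp (- (u\<^sup>2 * (v - a / T n) / 2)))"
    define h where "h U = (CLINT V|measure_pmf (urn_step U). iexp (u * colour_sum b V))
        - iexp (u' * colour_sum b U) * e" for U
    have "\<bar>1 - 1 / T n\<bar> \<le> 1"
      using T1[of n] by (auto simp: field_simps)
    then have u'_le: "\<bar>u'\<bar> \<le> \<bar>u\<bar>"
      by (simp add: u'_def abs_mult mult_left_le)
    then have u'_sq: "u'\<^sup>2 \<le> u\<^sup>2" "\<bar>u'\<bar> ^ 3 \<le> \<bar>u\<bar> ^ 3" "u' ^ 4 \<le> u ^ 4"
      using power_mono[OF u'_le, of 2] power_mono[OF u'_le, of 3] power_mono[OF u'_le, of 4] by simp_all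
    have "?E (\<lambda>U. h U + iexp (u' * colour_sum b U) * e) = ?E h + \<phi> n u' * e"
      by (simp only: urn_expectation_add integral_mult_left_zero \<phi>_def)
    then have \<phi>_Suc: "\<phi> (Suc n) u = ?E h + \<phi> n u' * e"
      unfolding \<phi>_def urn_expectation_Suc by (simp only: h_def diff_add_cancel)
    \<comment> \<open>The correction \<open>a / T\<close> makes this exact: with
      \<open>v = a * (?q + 1)\<close> and \<open>T * (1 - 1 / T)^2 = T - 2 + 1 / T\<close>, the
      right side collapses to \<open>a * (T + ?q - 1)\<close>, up to the factor
      \<open>u^2 / 2\<close>.\<close>
    have "u\<^sup>2 * a * T (Suc n) / 2 = u\<^sup>2 * (v - a / T n) / 2 + u'\<^sup>2 * a * T n / 2"
    proof -
      have T_Suc: "T (Suc n) = T n + (?q - 1)"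
        by (simp add: T_def algebra_simps)
      have v_a: "v = a * (?q + 1)"
        by (simp add: a_v add_nonneg_eq_0_iff)
      have "T n \<noteq> 0"
        using T1[of n] by simp
      then show ?thesis
        unfolding T_Suc v_a by (simp add: u'_def field_simps power2_eq_square)
    qed
    then have "- (u\<^sup>2 * a * T (Suc n) / 2) = - (u'\<^sup>2 * a * T n / 2) + - (u\<^sup>2 * (v - a / T n) / 2)"
      by linarith
    then have g_Suc: "g (Suc n) u = g n u' * e"
      by (simp only: g_def e_def exp_add of_real_mult)
    have e1: "cmod e \<le> 1"
    proof -
      have "a \<le> v"
        using a0 by (simp add: a_v field_simps)
      then have "a / T n \<le> v"
        using mult_mono[of 1 "T n" a v] a0 T1[of n] by (auto simp: field_simps)
      then show ?thesis
        by (simp add: e_def)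
    qed
    have "cmod (?E h) \<le> ?E (\<lambda>U. cmod (h U))"
      by (rule integral_norm_bound)
    also have "\<dots> \<le> ?E (\<lambda>U. \<bar>u\<bar> ^ 3 * B ^ 3 + u ^ 4 * B ^ 4 + u\<^sup>2 * B\<^sup>2 / (2 * T n)
        + u\<^sup>2 * \<bar>colour_sum b2 U\<bar> / (2 * T n) + u\<^sup>2 * (colour_sum b U)\<^sup>2 / (2 * (T n)\<^sup>2))"
    proof (rule urn_expectation_mono)
      fix U
      assume U: "U \<in> set_pmf (urn_law U0 n)"
      note size = urn_law_size[OF U0 U]
      have "real (size U) = T n"
        by (simp add: size T_def)
      with urn_step_char[OF size(1) b B(1) v_def, of u]
      show "cmod (h U) \<le> \<bar>u\<bar> ^ 3 * B ^ 3 + u ^ 4 * B ^ 4 + u\<^sup>2 * B\<^sup>2 / (2 * T n)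
        + u\<^sup>2 * \<bar>colour_sum b2 U\<bar> / (2 * T n) + u\<^sup>2 * (colour_sum b U)\<^sup>2 / (2 * (T n)\<^sup>2)"
        by (simp only: h_def e_def u'_def a_v b2_def[abs_def])
    qed
    also have "\<dots> \<le> \<bar>u\<bar> ^ 3 * B ^ 3 + u ^ 4 * B ^ 4 + (B\<^sup>2 + K + 1) * (u\<^sup>2 / sqrt (real n + 1))"
      unfolding T_def
      using urn_second_moment[OF U0 b B(1), of n] urn_second_moment[OF U0 b2 B(2), of n] K[of b n] K[of b2 n]
      by (intro expected_error_le[OF q U0 K0]) auto
    also have "\<dots> \<le> \<bar>u\<bar> ^ 3 * C + u ^ 4 * C + C * (u\<^sup>2 / sqrt (real n + 1))"
      by (intro add_mono mult_left_mono mult_right_mono C) auto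
    also have "\<dots> = err n u"
      by (simp add: err_def algebra_simps)
    finally have Eh: "cmod (?E h) \<le> err n u" .
    have err_mono: "err k u' \<le> err k u" for k
      unfolding err_def by (intro mult_left_mono add_mono divide_right_mono u'_sq C0) auto
    have "\<phi> (Suc n) u - g (Suc n) u = ?E h + (\<phi> n u' - g n u') * e"
      by (simp add: \<phi>_Suc g_Suc algebra_simps)
    also have "cmod \<dots> \<le> err n u + cmod (\<phi> n u' - g n u') * 1"
      unfolding norm_mult[symmetric]
      by (intro norm_triangle_mono Eh) (unfold norm_mult, intro mult_left_mono e1, simp)
    also have "\<dots> \<le> err n u + (C * (\<bar>u'\<bar> + u'\<^sup>2) + (\<Sum>k<n. err k u'))"
      using Suc[of u'] by simp
    also have "\<dots> \<le> err n u + (C * (\<bar>u\<bar> + u\<^sup>2) + (\<Sum>k<n. err k u))"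
      by (intro add_left_mono add_mono mult_left_mono sum_mono err_mono u'_le u'_sq C0)
    finally show ?case
      by simp
  qed
  then show thesis
    using that[OF C0] by (simp only: \<phi>_def g_def err_def)
qed

text \<open>At \<open>u = 1 / sqrt n\<close> the accumulated terms are \<open>n * u^3 = u\<close>,
  \<open>n * u^4 = u^2\<close> and at most \<open>u^2 * 2 * sqrt n = 2 * u\<close>, up to a
  constant. So the error vanishes, while \<open>u^2 * T n\<close> tends to
  \<open>CARD('q) - 1\<close>.\<close>

theorem urn_char_tendsto:
  fixes U0 :: "'q::finite multiset" and b :: "'q \<Rightarrow> real"
  assumes q: "CARD('q) \<ge> 2" and U0: "U0 \<noteq> {#}" and b: "(\<Sum>j\<in>UNIV. b j) = 0"
  shows "(\<lambda>n. CLINT U|measure_pmf (urn_law U0 n). iexp (colour_sum b U / sqrt (real n)))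
    \<longlonglongrightarrow> exp (- ((real CARD('q) - 1) / (real CARD('q) * (real CARD('q) + 1)) * (\<Sum>j\<in>UNIV. (b j)\<^sup>2)) / 2)"
proof -
  let ?q = "real CARD('q)"
  define a where "a = (\<Sum>j\<in>UNIV. (b j)\<^sup>2) / ?q / (?q + 1)"
  define T where "T n = real (size U0) + real n * (?q - 1)" for n
  define \<phi> where "\<phi> n = (CLINT U|measure_pmf (urn_law U0 n). iexp (colour_sum b U / sqrt (real n)))" for n
  define g where "g n = complex_of_real (exp (- ((1 / sqrt (real n))\<^sup>2 * a * T n / 2)))" for n
  obtain C where C: "C \<ge> 0" "\<And>n u. cmod ((CLINT U|measure_pmf (urn_law U0 n). iexp (u * colour_sum b U))
        - exp (- (u\<^sup>2 * a * T n / 2)))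
      \<le> C * (\<bar>u\<bar> + u\<^sup>2) + (\<Sum>k<n. C * (\<bar>u\<bar> ^ 3 + u ^ 4 + u\<^sup>2 / sqrt (real k + 1)))"
    using urn_char_error[OF q U0 b] unfolding a_def T_def by blast
  have "(\<lambda>n. \<phi> n - g n) \<longlonglongrightarrow> 0"
  proof (rule Lim_null_comparison)
    show "\<forall>\<^sub>F n in sequentially. norm (\<phi> n - g n) \<le> C * (4 * (1 / sqrt (real n)) + 2 * (1 / sqrt (real n))\<^sup>2)"
      using eventually_gt_at_top[of 0]
    proof eventually_elim
      case (elim n)
      define u where "u = 1 / sqrt (real n)"
      have u: "u > 0" "real n * u\<^sup>2 = 1" "sqrt (real n) * u = 1"
        using elim by (auto simp: u_def power_divide)
      have "norm (\<phi> n - g n) \<le> C * (\<bar>u\<bar> + u\<^sup>2) + (\<Sum>k<n. C * (\<bar>u\<bar> ^ 3 + u ^ 4 + u\<^sup>2 / sqrt (real k + 1)))"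
        using C(2)[of n u] by (simp add: \<phi>_def g_def u_def)
      also have "\<dots> = C * (u + u\<^sup>2 + real n * (u ^ 3 + u ^ 4) + u\<^sup>2 * (\<Sum>k<n. 1 / sqrt (real k + 1)))"
        using u(1) by (simp add: sum.distrib sum_distrib_left algebra_simps)
      also have "\<dots> \<le> C * (u + u\<^sup>2 + real n * (u ^ 3 + u ^ 4) + u\<^sup>2 * (2 * sqrt (real n)))"
        using sum_inverse_sqrt_le[of n] by (intro mult_left_mono add_left_mono C) auto
      also have "real n * (u ^ 3 + u ^ 4) = (real n * u\<^sup>2) * (u + u\<^sup>2)"
        by (simp add: eval_nat_numeral algebra_simps)
      also have "u\<^sup>2 * (2 * sqrt (real n)) = 2 * u * (sqrt (real n) * u)"
        by (simp add: power2_eq_square)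
      finally show ?case
        unfolding u by (simp add: u_def algebra_simps)
    qed
    show "(\<lambda>n. C * (4 * (1 / sqrt (real n)) + 2 * (1 / sqrt (real n))\<^sup>2)) \<longlonglongrightarrow> 0"
      by real_asymp
  qed
  moreover have "g \<longlonglongrightarrow> exp (- (a * (?q - 1) / 2))"
  proof -
    have "(\<lambda>n. (1 / sqrt (real n))\<^sup>2 * T n) \<longlonglongrightarrow> ?q - 1"
      unfolding T_def by real_asymp
    then have "(\<lambda>n. exp (- (a * ((1 / sqrt (real n))\<^sup>2 * T n) / 2))) \<longlonglongrightarrow> exp (- (a * (?q - 1) / 2))"
      by (intro tendsto_intros) simp_all
    then show ?thesis
      unfolding g_def by (intro tendsto_of_real) (simp add: mult.left_commute mult.assoc)
  qed
  ultimately have "(\<lambda>n. (\<phi> n - g n) + g n) \<longlonglongrightarrow> 0 + complex_of_real (exp (- (a * (?q - 1) / 2)))"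
    by (rule tendsto_add)
  moreover have "a * (?q - 1) = (?q - 1) / (?q * (?q + 1)) * (\<Sum>j\<in>UNIV. (b j)\<^sup>2)"
    by (simp add: a_def)
  ultimately show ?thesis
    by (simp add: \<phi>_def)
qed

section \<open>Characteristic functions and tightness of the normalised counts\<close>

text \<open>When \<open>t\<close> is split into its mean and a centred part, the mean sees only the
  deterministic number of balls. The normalisation removes its linear growth and leaves the initial
  size.\<close>

lemma inner_normalised_counts:
  fixes U0 :: "'q::finite multiset" and t :: "real ^ 'q"
  assumes U0: "U0 \<noteq> {#}" and U: "U \<in> set_pmf (urn_law U0 n)"
  defines "m \<equiv> (\<Sum>j\<in>UNIV. t $ j) / real CARD('q)"
  shows "t \<bullet> normalised_counts n U =
    (colour_sum (\<lambda>j. t $ j - m) U + m * real (size U0)) / sqrt (real n)"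
proof -
  let ?q = "real CARD('q)"
  have "t \<bullet> normalised_counts n U =
      (\<Sum>j\<in>UNIV. t $ j * real (count U j) - t $ j * ((?q - 1) / ?q * real n)) / sqrt (real n)"
    by (simp add: inner_vec_def normalised_counts_def right_diff_distrib flip: sum_divide_distrib)
  also have "(\<Sum>j\<in>UNIV. t $ j * real (count U j) - t $ j * ((?q - 1) / ?q * real n)) =
      colour_sum (($) t) U - (?q - 1) * real n * m"
    by (simp only: sum_subtractf colour_sum_def m_def sum_distrib_right[symmetric]) (simp add: mult_ac)
  also have "colour_sum (($) t) U = colour_sum (\<lambda>j. t $ j - m) U + m * real (size U)"
    using colour_sum_add[of "\<lambda>j. t $ j - m" "\<lambda>_. m" U] by (simp add: colour_sum_const)
  also have "\<dots> - (?q - 1) * real n * m = colour_sum (\<lambda>j. t $ j - m) U + m * real (size U0)"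
    unfolding urn_law_size(2)[OF U0 U] by (simp add: algebra_simps)
  finally show ?thesis .
qed

lemma sum_centred:
  fixes t :: "real ^ 'q::finite"
  shows "(\<Sum>j\<in>UNIV. t $ j - (\<Sum>i\<in>UNIV. t $ i) / real CARD('q)) = 0"
  by (simp add: sum_subtractf)

text \<open>The offset from the initial number of balls is deterministic and of order
  \<open>1 / sqrt n\<close>, so it contributes a factor tending to 1.\<close>

lemma normalised_counts_char_tendsto:
  fixes U0 :: "'q::finite multiset" and t :: "real ^ 'q"
  assumes q: "CARD('q) \<ge> 2" and U0: "U0 \<noteq> {#}"
  defines "m \<equiv> (\<Sum>j\<in>UNIV. t $ j) / real CARD('q)"
  shows "(\<lambda>n. CLINT U|measure_pmf (urn_law U0 n). iexp (t \<bullet> normalised_counts n U)) \<longlonglongrightarrow>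
    exp (- ((real CARD('q) - 1) / (real CARD('q) * (real CARD('q) + 1)) * (\<Sum>j\<in>UNIV. (t $ j - m)\<^sup>2)) / 2)"
    (is "_ \<longlonglongrightarrow> ?L")
proof -
  have eq: "(CLINT U|measure_pmf (urn_law U0 n). iexp (t \<bullet> normalised_counts n U)) =
      (CLINT U|measure_pmf (urn_law U0 n). iexp (colour_sum (\<lambda>j. t $ j - m) U / sqrt (real n)))
      * iexp (m * real (size U0) / sqrt (real n))" for n
  proof -
    have "(CLINT U|measure_pmf (urn_law U0 n). iexp (t \<bullet> normalised_counts n U)) =
      (CLINT U|measure_pmf (urn_law U0 n). iexp (colour_sum (\<lambda>j. t $ j - m) U / sqrt (real n))
        * iexp (m * real (size U0) / sqrt (real n)))"
    proof (intro integral_cong_AE AE_pmfI)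
      fix U
      assume "U \<in> set_pmf (urn_law U0 n)"
      then have "t \<bullet> normalised_counts n U = colour_sum (\<lambda>j. t $ j - m) U / sqrt (real n)
          + m * real (size U0) / sqrt (real n)"
        unfolding m_def by (subst inner_normalised_counts[OF U0]) (auto simp: add_divide_distrib)
      then show "iexp (t \<bullet> normalised_counts n U) = iexp (colour_sum (\<lambda>j. t $ j - m) U / sqrt (real n))
          * iexp (m * real (size U0) / sqrt (real n))"
        by (simp only: iexp_add)
    qed simp_all
    then show ?thesis
      by (simp only: integral_mult_left_zero)
  qed
  have "(\<lambda>n. m * real (size U0) / sqrt (real n)) \<longlonglongrightarrow> 0"
    by real_asymp
  then have "(\<lambda>n. iexp (m * real (size U0) / sqrt (real n))) \<longlonglongrightarrow> iexp 0"
    by (intro tendsto_intros)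
  with urn_char_tendsto[OF q U0 sum_centred[of t, folded m_def]]
  have "(\<lambda>n. (CLINT U|measure_pmf (urn_law U0 n). iexp (colour_sum (\<lambda>j. t $ j - m) U / sqrt (real n)))
      * iexp (m * real (size U0) / sqrt (real n))) \<longlonglongrightarrow> ?L * iexp 0"
    by (rule tendsto_mult)
  then show ?thesis
    unfolding eq by simp
qed

text \<open>Before scaling, each coordinate is a centred functional with weights in
  \<open>[-1, 1]\<close> plus a bounded offset, so its second moment grows at most linearly and
  division by \<open>n\<close> bounds it.\<close>

lemma normalised_counts_second_moment:
  fixes U0 :: "'q::finite multiset"
  assumes U0: "U0 \<noteq> {#}"
  shows "urn_expectation U0 n (\<lambda>U. (norm (normalised_counts n U))\<^sup>2)
    \<le> real CARD('q) * (4 * (real (size U0))\<^sup>2 + 2)"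
proof -
  let ?q = "real CARD('q)" and ?T0 = "real (size U0)"
  have coordinate: "urn_expectation U0 n (\<lambda>U. (normalised_counts n U $ j)\<^sup>2) \<le> 4 * ?T0\<^sup>2 + 2" for j
  proof (cases "n = 0")
    \<comment> \<open>Division by \<open>sqrt 0\<close> yields 0, so the normalised vector vanishes
      at time 0.\<close>
    case True
    then show ?thesis
      by (simp add: normalised_counts_def)
  next
    case False
    then have n: "real n \<ge> 1"
      by simp
    define b :: "'q \<Rightarrow> real" where "b i = axis j 1 $ i - 1 / ?q" for i
    have sum_axis: "(\<Sum>i\<in>UNIV. axis j (1 :: real) $ i) = 1"
      by (simp add: axis_def)
    have b: "(\<Sum>i\<in>UNIV. b i) = 0"
      unfolding b_def using sum_centred[of "axis j 1"] by (simp add: sum_axis)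
    have b1: "\<bar>b i\<bar> \<le> 1" for i
      by (auto simp: b_def axis_def field_simps)
    have "urn_expectation U0 n (\<lambda>U. (normalised_counts n U $ j)\<^sup>2) \<le>
        urn_expectation U0 n (\<lambda>U. (2 * (colour_sum b U)\<^sup>2 + 2 * ?T0\<^sup>2) / real n)"
    proof (rule urn_expectation_mono)
      fix U
      assume U: "U \<in> set_pmf (urn_law U0 n)"
      let ?Z = "colour_sum b U"
      have "normalised_counts n U $ j = (?Z + ?T0 / ?q) / sqrt (real n)"
        using inner_normalised_counts[OF U0 U, of "axis j 1"]
        by (simp add: inner_axis' sum_axis b_def[abs_def])
      then have "(normalised_counts n U $ j)\<^sup>2 = (?Z + ?T0 / ?q)\<^sup>2 / real n"
        by (simp add: power_divide)
      also have "\<dots> \<le> (2 * ?Z\<^sup>2 + 2 * ?T0\<^sup>2) / real n"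
      proof (rule divide_right_mono)
        have "(?Z + ?T0 / ?q)\<^sup>2 \<le> 2 * ?Z\<^sup>2 + 2 * (?T0 / ?q)\<^sup>2"
          using sum_squares_bound[of ?Z "?T0 / ?q"] by (simp add: power2_sum)
        moreover have "(?T0 / ?q)\<^sup>2 \<le> ?T0\<^sup>2"
          by (intro power_mono) (simp_all add: divide_le_eq mult_le_cancel_left1 Suc_le_eq)
        ultimately show "(?Z + ?T0 / ?q)\<^sup>2 \<le> 2 * ?Z\<^sup>2 + 2 * ?T0\<^sup>2"
          by linarith
      qed simp
      finally show "(normalised_counts n U $ j)\<^sup>2 \<le> (2 * ?Z\<^sup>2 + 2 * ?T0\<^sup>2) / real n" .
    qed
    also have "\<dots> = (2 * urn_expectation U0 n (\<lambda>U. (colour_sum b U)\<^sup>2) + 2 * ?T0\<^sup>2) / real n"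
      by simp
    also have "\<dots> \<le> (2 * (?T0\<^sup>2 + real n) + 2 * ?T0\<^sup>2) / real n"
    proof -
      have "\<bar>colour_sum b U0\<bar> \<le> ?T0"
        using abs_colour_sum_le[of b 1 U0] b1 by simp
      then have "(colour_sum b U0)\<^sup>2 \<le> ?T0\<^sup>2"
        by (simp add: abs_le_square_iff[symmetric])
      then have "urn_expectation U0 n (\<lambda>U. (colour_sum b U)\<^sup>2) \<le> ?T0\<^sup>2 + real n"
        using urn_second_moment[OF U0 b b1, of n] by simp
      then show ?thesis
        by (intro divide_right_mono) auto
    qed
    also have "\<dots> \<le> 4 * ?T0\<^sup>2 + 2"
      using n mult_right_mono[OF n, of "4 * ?T0\<^sup>2"] by (simp add: divide_le_eq algebra_simps)
    finally show ?thesis .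
  qed
  have "(norm (normalised_counts n U))\<^sup>2 = (\<Sum>j\<in>UNIV. (normalised_counts n U $ j)\<^sup>2)" for U :: "'q multiset"
    by (simp add: norm_vec_def L2_set_def sum_nonneg)
  then have "urn_expectation U0 n (\<lambda>U. (norm (normalised_counts n U))\<^sup>2) =
      (\<Sum>j\<in>UNIV. urn_expectation U0 n (\<lambda>U. (normalised_counts n U $ j)\<^sup>2))"
    by (simp add: Bochner_Integration.integral_sum)
  also have "\<dots> \<le> (\<Sum>j\<in>(UNIV :: 'q set). 4 * ?T0\<^sup>2 + 2)"
    by (intro sum_mono coordinate)
  finally show ?thesis
    by simp
qed

text \<open>Chebyshev's inequality with the uniform second moment bound \<open>K\<close>;
  \<open>r\<close> is chosen so that \<open>K / r^2 = e\<close>.\<close>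

lemma normalised_counts_tight:
  fixes U0 :: "'q::finite multiset"
  assumes U0: "U0 \<noteq> {#}" and e: "e > 0"
  shows "\<exists>r. \<forall>n. measure (distr (measure_pmf (urn_law U0 n)) borel (normalised_counts n)) {x. r < norm x} \<le> e"
proof -
  define K where "K = real CARD('q) * (4 * (real (size U0))\<^sup>2 + 2)"
  have K: "K > 0"
    by (simp add: K_def add_nonneg_pos)
  define r where "r = sqrt (K / e)"
  have r: "r > 0" "r\<^sup>2 = K / e"
    using K e by (auto simp: r_def)
  have "measure (distr (measure_pmf (urn_law U0 n)) borel (normalised_counts n)) {x. r < norm x} \<le> e" for n
  proof -
    let ?S = "{U. r < norm (normalised_counts n U)}"
    have "{x. r < norm x} \<in> sets (borel :: (real ^ 'q) measure)"
      by (intro borel_open open_Collect_less continuous_intros)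
    then have "measure (distr (measure_pmf (urn_law U0 n)) borel (normalised_counts n)) {x. r < norm x} =
        measure (measure_pmf (urn_law U0 n)) ?S"
      by (subst measure_distr) (auto simp: vimage_def)
    also have "\<dots> = urn_expectation U0 n (indicator ?S)"
      by simp
    also have "\<dots> \<le> urn_expectation U0 n (\<lambda>U. (norm (normalised_counts n U))\<^sup>2 / r\<^sup>2)"
    proof (rule urn_expectation_mono)
      fix U
      show "indicator ?S U \<le> (norm (normalised_counts n U))\<^sup>2 / r\<^sup>2"
        using r(1) by (auto simp: indicator_def intro!: power_mono)
    qed
    also have "\<dots> = urn_expectation U0 n (\<lambda>U. (norm (normalised_counts n U))\<^sup>2) / r\<^sup>2"
      by simp
    also have "\<dots> \<le> K / r\<^sup>2"
      unfolding K_def by (intro divide_right_mono normalised_counts_second_moment U0) simp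
    also have "\<dots> = e"
      using K e by (simp add: r)
    finally show ?thesis .
  qed
  then show ?thesis
    by blast
qed

section \<open>The Gaussian limit and joint convergence\<close>

text \<open>The \<open>w j\<close> are the unit vectors projected orthogonally to the all-ones
  vector and scaled by \<open>sqrt c\<close>, so pairing with \<open>t\<close> centres its
  coordinates. The limit is degenerate in the all-ones direction, as the total number of balls is
  deterministic.\<close>

lemma urn_limit_exists:
  assumes "CARD('q::finite) \<ge> 2"
  obtains \<zeta> :: "(real ^ 'q) measure" where "prob_space \<zeta>" "sets \<zeta> = sets borel"
    "\<And>t. distr \<zeta> borel (\<lambda>z. t \<bullet> z) = centred_normal
      ((real CARD('q) - 1) / (real CARD('q) * (real CARD('q) + 1))
        * (\<Sum>j\<in>UNIV. (t $ j - (\<Sum>i\<in>UNIV. t $ i) / real CARD('q))\<^sup>2))"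
proof -
  let ?q = "real CARD('q)"
  define c where "c = (?q - 1) / (?q * (?q + 1))"
  have c: "c \<ge> 0"
    using assms by (simp add: c_def)
  define w :: "'q \<Rightarrow> real ^ 'q" where "w j = sqrt c *\<^sub>R (axis j 1 - (\<chi> i. 1 / ?q))" for j
  have "(t \<bullet> w j)\<^sup>2 = c * (t $ j - (\<Sum>i\<in>UNIV. t $ i) / ?q)\<^sup>2" for t :: "real ^ 'q" and j
  proof -
    have "t \<bullet> (\<chi> i. 1 / ?q) = (\<Sum>i\<in>UNIV. t $ i) / ?q"
      by (simp add: inner_vec_def sum_divide_distrib)
    then have "t \<bullet> w j = sqrt c * (t $ j - (\<Sum>i\<in>UNIV. t $ i) / ?q)"
      by (simp add: w_def inner_diff_right inner_axis)
    then show ?thesis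
      using c by (simp add: power_mult_distrib)
  qed
  then have sum_w: "(\<Sum>j\<in>UNIV. (t \<bullet> w j)\<^sup>2) = c * (\<Sum>j\<in>UNIV. (t $ j - (\<Sum>i\<in>UNIV. t $ i) / ?q)\<^sup>2)" for t
    by (simp only: sum_distrib_left)
  obtain \<zeta> :: "(real ^ 'q) measure" where \<zeta>: "prob_space \<zeta>" "sets \<zeta> = sets borel"
    and law: "\<And>t. distr \<zeta> borel (\<lambda>z. t \<bullet> z) = centred_normal (\<Sum>j\<in>UNIV. (t \<bullet> w j)\<^sup>2)"
    using gaussian_vector_exists[of w] by blast
  show thesis
    by (rule that[OF \<zeta>]) (unfold law sum_w c_def, rule refl)
qed

theorem theorem5p3:
  fixes U0 :: "'q::finite multiset"
  assumes "CARD('q) \<ge> 2"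
    and "U0 \<noteq> {#}"
  shows "\<exists>\<zeta> :: (real ^ 'q) measure.
    jointly_normal_law \<zeta> \<and>
    (\<forall>j. integral\<^sup>L \<zeta> (\<lambda>z. z $ j) = 0) \<and>
    (\<forall>i j. covariance \<zeta> (\<lambda>z. z $ i) (\<lambda>z. z $ j) =
       (real CARD('q) - 1) / ((real CARD('q))\<^sup>2 * (real CARD('q) + 1))
         * (real CARD('q) * (if i = j then 1 else 0) - 1)) \<and>
    weakly_converges
      (\<lambda>n. distr (measure_pmf (urn_law U0 n)) borel (normalised_counts n)) \<zeta>"
proof -
  let ?q = "real CARD('q)"
  define c where "c = (?q - 1) / (?q * (?q + 1))"
  define v where "v t = c * (\<Sum>j\<in>UNIV. (t $ j - (\<Sum>i\<in>UNIV. t $ i) / ?q)\<^sup>2)" for t :: "real ^ 'q"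
  obtain \<zeta> :: "(real ^ 'q) measure" where \<zeta>: "prob_space \<zeta>" "sets \<zeta> = sets borel"
    and law: "\<And>t. distr \<zeta> borel (\<lambda>z. t \<bullet> z) = centred_normal (v t)"
    using urn_limit_exists[OF assms(1)] unfolding v_def c_def by blast
  have "c \<ge> 0"
    using assms(1) by (simp add: c_def)
  then have v0: "v t \<ge> 0" for t
    by (simp add: v_def sum_nonneg)
  \<comment> \<open>This closed form is easy to evaluate at unit vectors and their sums, as
    polarisation requires.\<close>
  have v: "v t = c * (t \<bullet> t - (\<Sum>j\<in>UNIV. t $ j)\<^sup>2 / ?q)" for t
  proof -
    let ?S = "\<Sum>i\<in>UNIV. t $ i"
    have "(\<Sum>j\<in>UNIV. (t $ j - ?S / ?q)\<^sup>2) =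
        (\<Sum>j\<in>UNIV. (t $ j)\<^sup>2 - 2 * (?S / ?q) * t $ j + (?S / ?q)\<^sup>2)"
      by (intro sum.cong refl) (simp add: power2_diff)
    also have "\<dots> = (\<Sum>j\<in>UNIV. (t $ j)\<^sup>2) - 2 * (?S / ?q) * ?S + ?q * (?S / ?q)\<^sup>2"
      by (simp add: sum.distrib sum_subtractf sum_distrib_left)
    also have "\<dots> = t \<bullet> t - ?S\<^sup>2 / ?q"
      by (simp add: power2_eq_square inner_vec_def)
    finally show ?thesis
      by (simp add: v_def)
  qed
  have component: "z $ j = axis j 1 \<bullet> z" for z :: "real ^ 'q" and j
    by (simp add: inner_axis')
  have "jointly_normal_law \<zeta>"
    using \<zeta> law v0 by (simp add: jointly_normal_law_def normal_law_centred_normal)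
  moreover have "integral\<^sup>L \<zeta> (\<lambda>z. z $ j) = 0" for j
    unfolding component by (rule gaussian_mean[OF \<zeta>(2) law v0])
  moreover have "covariance \<zeta> (\<lambda>z. z $ i) (\<lambda>z. z $ j) =
       (?q - 1) / (?q\<^sup>2 * (?q + 1)) * (?q * (if i = j then 1 else 0) - 1)" for i j
  proof -
    have sum_axis: "(\<Sum>k\<in>UNIV. axis l (1 :: real) $ k) = 1" for l :: 'q
      by (simp add: axis_def)
    define d :: real where "d = (if i = j then 1 else 0)"
    \<comment> \<open>For \<open>i = j\<close> the argument is twice a unit vector. In both cases
      its squared norm is \<open>2 + 2 * d\<close> and its coordinates sum to 2.\<close>
    have v_sum: "v (axis i 1 + axis j 1) = c * (2 + 2 * d - 4 * (1 / ?q))"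
      by (simp add: v d_def sum.distrib sum_axis inner_add_left inner_add_right inner_axis_axis)
    have v_axis: "v (axis l 1) = c * (1 - 1 / ?q)" for l
      by (simp add: v sum_axis inner_axis_axis)
    have "(c * (2 + 2 * d - 4 * r) - c * (1 - r) - c * (1 - r)) / 2 = c * (d - r)" for r
      by (simp add: field_simps)
    then have "covariance \<zeta> (\<lambda>z. z $ i) (\<lambda>z. z $ j) = c * (d - 1 / ?q)"
      unfolding component gaussian_covariance[OF \<zeta>(2) law v0] v_sum v_axis .
    also have "\<dots> = (?q - 1) / (?q\<^sup>2 * (?q + 1)) * (?q * d - 1)"
      by (simp add: c_def power2_eq_square right_diff_distrib)
    finally show ?thesis
      by (simp only: d_def)
  qed
  moreover have "weakly_converges (\<lambda>n. distr (measure_pmf (urn_law U0 n)) borel (normalised_counts n)) \<zeta>"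
  proof (rule weakly_converges_if_char_tendsto)
    show "prob_space (distr (measure_pmf (urn_law U0 n)) borel (normalised_counts n))" for n
      by (rule measure_pmf.prob_space_distr) simp
    have "(CLINT x|distr (measure_pmf (urn_law U0 n)) borel (normalised_counts n). iexp (t \<bullet> x)) =
        (CLINT U|measure_pmf (urn_law U0 n). iexp (t \<bullet> normalised_counts n U))" for n t
      by (rule integral_distr) measurable
    then show "(\<lambda>n. CLINT x|distr (measure_pmf (urn_law U0 n)) borel (normalised_counts n). iexp (t \<bullet> x))
        \<longlonglongrightarrow> (CLINT x|\<zeta>. iexp (t \<bullet> x))" for t
      using normalised_counts_char_tendsto[OF assms, of t]
      unfolding gaussian_char[OF \<zeta>(2) law v0] v_def c_def by (simp only:)
    show "\<exists>r. \<forall>n. measure (distr (measure_pmf (urn_law U0 n)) borel (normalised_counts n)) {x. r < norm x} \<le> e"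
      if "e > 0" for e
      using normalised_counts_tight[OF assms(2) that] .
  qed (use \<zeta> in simp_all)
  ultimately show ?thesis
    by blast
qed

end
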